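(* Let $(\mathsf H,L)$ be a canonical system. Suppose that for a.e. $x\in[0,L]$ either $\mathsf H(x)=\mathfrak H_1$ or $\mathsf H(x)=\mathfrak H_2$, where $\mathfrak H_1=\begin{pmatrix}1&0\\0&0\end{pmatrix}$ and $\mathfrak H_2=\begin{pmatrix}0&0\\0&1\end{pmatrix}$. Let $X_1=\{x\in(0,L):\mathsf H(x)=\mathfrak H_1\}$ and $X_2=\{x\in(0,L):\mathsf H(x)=\mathfrak H_2\}$, and let $|\cdot|$ denote Lebesgue measure. Then the order of the system $(\mathsf H,L)$ coincides with the infimum of those $d$, $0<d<1$, for which there exists a positive $C=C(d)$ such that for each $R$ large enough there exists a covering of the interval $(0,L)$ by $n=n(R)$ intervals $\omega_j$ such that (A) $\displaystyle \sum_{j}\sqrt{|\omega_j\cap X_1|\,|\omega_j\cap X_2|}\le C R^{d-1}$; (B) $n(R)\le C R^{d}$.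
   Context: Canonical systems. Let $L>0$ and let $\mathsf H$ be a summable function on $[0,L]$ with values in $2\times2$ matrices such that $\mathsf H(x)\ge0$ and $\operatorname{tr}\mathsf H(x)=1$ for a.e. $x$. Let $J=\begin{pmatrix}0&-1\\1&0\end{pmatrix}$. The canonical system $(\mathsf H,L)$ is the matrix differential equation $J\frac{dY}{dx}=z\mathsf H Y$, $z\in\mathbb C$, $x\in[0,L]$; $\mathsf H$ is called its Hamiltonian. The solution $M(x,z)$ of this equation satisfying $M(0,z)=I$ is called the monodromy matrix, and one writes $M(z)=M(L,z)$. Order. The quantity $\limsup_{|z|\to\infty}\frac{\log\log|M_{ij}(z)|}{\log|z|}$ does not depend on $i,j$ and is called the order of the system. *)

theory Defs
  imports "HOL-Analysis.Analysis"
begin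

text \<open>For complex matrices, nonnegativity of the form below already forces \<open>A\<close> to be Hermitian.\<close>

definition pos_semidef :: "complex^2^2 \<Rightarrow> bool" where
  "pos_semidef A \<longleftrightarrow>
     (\<forall>v :: complex^2. (\<Sum>i\<in>UNIV. \<Sum>j\<in>UNIV. cnj (v $ i) * A $ i $ j * v $ j) \<in> \<real>\<^sub>\<ge>\<^sub>0)"

definition canonical_system :: "(real \<Rightarrow> complex^2^2) \<Rightarrow> real \<Rightarrow> bool" where
  "canonical_system H L \<longleftrightarrow>
     L > 0 \<and> integrable (lebesgue_on {0..L}) H \<and>
     (AE x in lebesgue_on {0..L}. pos_semidef (H x) \<and> trace (H x) = 1)"

definition symplJ :: "complex^2^2" where
  "symplJ = vector [vector [0, -1], vector [1, 0]]"

text \<open>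
  As \<open>H\<close> is merely summable, \<open>J M' = z H M\<close>, \<open>M(0,z) = I\<close> is meant in the sense of
  Caratheodory (\<open>M(\<cdot>,z)\<close> absolutely continuous, equation a.e.), that is, in integrated form.
  The Bochner integral below exists since \<open>H\<close> is integrable and \<open>M(\<cdot>,z)\<close> is continuous.
\<close>

definition monodromy_matrix ::
  "(real \<Rightarrow> complex^2^2) \<Rightarrow> real \<Rightarrow> (real \<Rightarrow> complex \<Rightarrow> complex^2^2) \<Rightarrow> bool" where
  "monodromy_matrix H L M \<longleftrightarrow>
     (\<forall>z. continuous_on {0..L} (\<lambda>x. M x z) \<and>
          (\<forall>x\<in>{0..L}. symplJ ** (M x z - mat 1) =
             mat z ** (LINT t|lebesgue_on {0..x}. H t ** M t z)))"

text \<open>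
  The limsup of \<open>log log \<bar>f z\<bar> / log \<bar>z\<bar>\<close> as \<open>\<bar>z\<bar> \<rightarrow> \<infinity>\<close>, with both outer logarithms truncated at 0.
  The truncation removes the points with \<open>\<bar>f z\<bar> \<le> 1\<close>, where the iterated logarithm is undefined
  (in particular neighbourhoods of zeros of \<open>f\<close>), and does not affect the limsup of a nonconstant
  entire function; a constant of modulus at most 1 gets order 0.
\<close>

definition growth_order :: "(complex \<Rightarrow> complex) \<Rightarrow> ereal" where
  "growth_order f =
     Limsup at_infinity (\<lambda>z. ereal (ln (max 1 (ln (max 1 (cmod (f z))))) / ln (cmod z)))"

definition frakH1 :: "complex^2^2" where
  "frakH1 = vector [vector [1, 0], vector [0, 0]]"

definition frakH2 :: "complex^2^2" where
  "frakH2 = vector [vector [0, 0], vector [0, 1]]"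

definition admissible_exponent :: "real set \<Rightarrow> real set \<Rightarrow> real \<Rightarrow> real \<Rightarrow> bool" where
  "admissible_exponent X1 X2 L d \<longleftrightarrow>
     (\<exists>C>0. \<forall>\<^sub>F R in at_top. \<exists>(n::nat) (\<omega> :: nat \<Rightarrow> real set).
        (\<forall>j<n. is_interval (\<omega> j)) \<and> {0<..<L} \<subseteq> (\<Union>j<n. \<omega> j) \<and>
        (\<Sum>j<n. sqrt (measure lebesgue (\<omega> j \<inter> X1) * measure lebesgue (\<omega> j \<inter> X2)))
          \<le> C * R powr (d - 1) \<and>
        real n \<le> C * R powr d)"

end

theory Submission
  imports Defs "HOL-Real_Asymp.Real_Asymp"
begin

text \<open>
  A column \<open>(u, w)\<close> of \<open>M\<close> satisfies \<open>u' = z \<chi>\<^sub>2 w\<close>, \<open>w' = - z \<chi>\<^sub>1 u\<close>, where \<open>\<chi>\<^sub>i\<close> is the indicator of \<open>X\<^sub>i\<close>.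

  Upper bound. Let \<open>\<bar>z\<bar> = R\<close> and let \<open>\<omega>\<close> be an interval with masses \<open>m\<^sub>i = \<bar>\<omega> \<inter> X\<^sub>i\<bar>\<close>. By Gronwall the weighted
  norm \<open>\<bar>u\<bar> + c \<bar>w\<bar>\<close> grows along \<open>\<omega>\<close> at most by \<open>exp (2 R (c m\<^sub>1 + m\<^sub>2 / c))\<close>. The weight
  \<open>c = sqrt (m\<^sub>2 / m\<^sub>1)\<close>, truncated to \<open>[1/R, R]\<close>, makes the exponent \<open>O(R sqrt (m\<^sub>1 m\<^sub>2) + m\<^sub>1 + m\<^sub>2)\<close>, and returning to
  the unweighted norm costs a factor \<open>R\<^sup>2\<close>. For a covering satisfying (A) and (B) the total
  growth is thus \<open>exp (O(R\<^sup>d log R))\<close>.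

  Lower bound. At \<open>z = i R\<close> the column turns into a nonnegative solution of \<open>u' = R \<chi>\<^sub>2 w\<close>,
  \<open>w' = R \<chi>\<^sub>1 u\<close>. Choose consecutive intervals greedily so that \<open>R\<^sup>2 m\<^sub>1 m\<^sub>2 = 1\<close> on each of them. Along
  each one the product \<open>u w\<close> is multiplied by at least 4, so a solution of size \<open>exp (R\<^sup>d)\<close> leaves
  room for only \<open>O(R\<^sup>d)\<close> intervals, and (A) holds because each contributes \<open>1/R\<close> to the sum.
\<close>

subsection \<open>A Gronwall inequality\<close>

text \<open>At the maximum point \<open>m\<close> the inequality gives
  \<open>p m \<le> p a + q * p m\<close>, where \<open>q \<le> 1/2\<close> is the integral of
  \<open>k\<close>. Solving for \<open>p m\<close> costs 1/(1 - q), which is at most exp(2q) because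
  (1 - q)(1 + 2q) \<ge> 1.\<close>

lemma gronwall_short_interval:
  fixes p k :: "real \<Rightarrow> real"
  assumes "a \<le> b" and p: "continuous_on {a..b} p" "\<And>x. x \<in> {a..b} \<Longrightarrow> 0 \<le> p x"
    and k: "k integrable_on {a..b}" "\<And>x. 0 \<le> k x"
    and kp: "\<And>t. t \<in> {a..b} \<Longrightarrow> (\<lambda>x. k x * p x) integrable_on {a..t}"
    and step: "\<And>t. t \<in> {a..b} \<Longrightarrow> p t \<le> p a + integral {a..t} (\<lambda>x. k x * p x)"
    and short: "integral {a..b} k \<le> 1/2"
  shows "p b \<le> p a * exp (2 * integral {a..b} k)"
proof -
  define q where "q = integral {a..b} k"
  obtain m where m: "m \<in> {a..b}" "\<And>x. x \<in> {a..b} \<Longrightarrow> p x \<le> p m"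
    using continuous_attains_sup[of "{a..b}" p] p(1) \<open>a \<le> b\<close> by fastforce
  have q: "0 \<le> q" "q \<le> 1/2"
    using short integral_nonneg[OF k(1)] k(2) by (auto simp: q_def)
  have k': "k integrable_on {a..m}"
    using integrable_on_subinterval[OF k(1), of a m] m(1) by auto
  have "p m \<le> p a + integral {a..m} (\<lambda>x. k x * p x)"
    by (rule step) (use m in auto)
  also have "integral {a..m} (\<lambda>x. k x * p x) \<le> integral {a..m} (\<lambda>x. k x * p m)"
  proof (rule integral_le)
    show "(\<lambda>x. k x * p m) integrable_on {a..m}"
      using integrable_on_mult_left[OF k', of "p m"] by simp
    show "k x * p x \<le> k x * p m" if "x \<in> {a..m}" for x
      using that m k(2) by (intro mult_left_mono) auto
  qed (use kp m in auto)
  also have "\<dots> = integral {a..m} k * p m"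
    by simp
  also have "\<dots> \<le> q * p m"
    unfolding q_def
    by (intro mult_right_mono integral_subset_le) (use m p k k' in auto)
  finally have pm: "p m * (1 - q) \<le> p a"
    by (simp add: algebra_simps)
  have "1 \<le> (1 - q) * exp (2 * q)"
  proof -
    have "1 \<le> (1 - q) * (1 + 2 * q)"
      using mult_nonneg_nonneg[of q "1 - 2 * q"] q by (simp add: algebra_simps)
    also have "\<dots> \<le> (1 - q) * exp (2 * q)"
      using q exp_ge_add_one_self[of "2 * q"] by (intro mult_left_mono) auto
    finally show ?thesis .
  qed
  then have "p m * 1 \<le> p m * ((1 - q) * exp (2 * q))"
    by (rule mult_left_mono) (use p(2)[OF m(1)] in auto)
  then have "p m \<le> (p m * (1 - q)) * exp (2 * q)"
    by (simp add: mult.assoc)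
  also have "\<dots> \<le> p a * exp (2 * q)"
    using pm by (rule mult_right_mono) simp
  finally have "p m \<le> p a * exp (2 * q)" .
  moreover have "p b \<le> p m"
    using m \<open>a \<le> b\<close> by auto
  ultimately show ?thesis
    by (simp add: q_def)
qed

text \<open>The bound \<open>B\<close> on \<open>k\<close> allows steps of a fixed length on which
  \<open>k\<close> has integral at most 1/2; induction over the steps multiplies the exponentials.
  The factor 2 in the exponent is inherited from the single step and is harmless for orders.\<close>

lemma gronwall_integral:
  fixes p k :: "real \<Rightarrow> real"
  assumes "a \<le> b" and p: "continuous_on {a..b} p" "\<And>x. x \<in> {a..b} \<Longrightarrow> 0 \<le> p x"
    and k: "k integrable_on {a..b}" "\<And>x. 0 \<le> k x" "\<And>x. k x \<le> B"
    and kp: "\<And>s t. \<lbrakk>a \<le> s; s \<le> t; t \<le> b\<rbrakk> \<Longrightarrow> (\<lambda>x. k x * p x) integrable_on {s..t}"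
    and step: "\<And>s t. \<lbrakk>a \<le> s; s \<le> t; t \<le> b\<rbrakk> \<Longrightarrow> p t \<le> p s + integral {s..t} (\<lambda>x. k x * p x)"
  shows "p b \<le> p a * exp (2 * integral {a..b} k)"
proof -
  \<comment> \<open>Chosen so that \<open>\<delta> * (\<bar>B\<bar> + 1) = 1/2\<close>; the added 1
    keeps the denominator positive.\<close>
  define \<delta> where "\<delta> = 1 / (2 * (\<bar>B\<bar> + 1))"
  have "\<delta> > 0"
    by (simp add: \<delta>_def)
  have sub: "k integrable_on {s..t}" if "a \<le> s" "t \<le> b" for s t
    using integrable_on_subinterval[OF k(1)] that by auto
  have *: "p t \<le> p a * exp (2 * integral {a..t} k)"
    if "a \<le> t" "t \<le> b" "t - a \<le> real n * \<delta>" for n t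
    using that
  proof (induction n arbitrary: t)
    case 0
    then show ?case by auto
  next
    case (Suc n)
    define s where "s = max a (t - \<delta>)"
    have s: "a \<le> s" "s \<le> t" "t - s \<le> \<delta>" "s - a \<le> real n * \<delta>"
      using Suc.prems \<open>\<delta> > 0\<close> by (auto simp: s_def algebra_simps)
    have "integral {s..t} k \<le> integral {s..t} (\<lambda>_. \<bar>B\<bar> + 1)"
      by (rule integral_le) (use k(3) sub s Suc.prems in \<open>auto simp: order_trans[OF _ abs_ge_self] intro: add_increasing2\<close>)
    also have "\<dots> = (t - s) * (\<bar>B\<bar> + 1)"
      using s by simp
    also have "\<dots> \<le> \<delta> * (\<bar>B\<bar> + 1)"
      using s by (intro mult_right_mono) auto
    also have "\<dots> = 1/2"
      by (simp add: \<delta>_def field_simps)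
    finally have short: "integral {s..t} k \<le> 1/2" .
    have "p t \<le> p s * exp (2 * integral {s..t} k)"
      by (rule gronwall_short_interval)
        (use s Suc.prems p k short sub kp step in \<open>auto intro: continuous_on_subset\<close>)
    also have "\<dots> \<le> p a * exp (2 * integral {a..s} k) * exp (2 * integral {s..t} k)"
      by (intro mult_right_mono Suc.IH) (use s Suc.prems in auto)
    also have "\<dots> = p a * exp (2 * integral {a..t} k)"
      using Henstock_Kurzweil_Integration.integral_combine[of a s t k] s Suc.prems sub
      by (simp add: mult.assoc flip: exp_add distrib_left)
    finally show ?case .
  qed
  obtain n where "(b - a) / \<delta> \<le> real n"
    using real_arch_simple by blast
  then show ?thesis
    using *[of b n] \<open>a \<le> b\<close> \<open>\<delta> > 0\<close> by (simp add: field_simps)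
qed

subsection \<open>Two-phase systems\<close>

lemma integrable_indicator_continuous:
  fixes f :: "real \<Rightarrow> 'a::euclidean_space"
  assumes X: "X \<in> sets lebesgue" and f: "continuous_on {a..b} f"
  shows "integrable (lebesgue_on {a..b}) (\<lambda>x. indicator X x *\<^sub>R f x)"
proof -
  have "integrable (lebesgue_on {a..b}) (\<lambda>x. indicator ({a..b} \<inter> X) x *\<^sub>R f x)"
    by (rule integrable_mult_indicator)
      (use X continuous_imp_integrable_real[OF f] in \<open>auto simp: sets_restrict_space\<close>)
  then show ?thesis
    by (rule Bochner_Integration.integrable_cong[THEN iffD1, rotated -1])
      (auto simp: indicator_def space_restrict_space)
qed

lemma indicator_continuous_integrable_on:
  fixes f :: "real \<Rightarrow> 'a::euclidean_space"
  assumes "X \<in> sets lebesgue" and "continuous_on {a..b} f"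
  shows "(\<lambda>x. indicator X x *\<^sub>R f x) integrable_on {a..b}"
  using integrable_on_lebesgue_on[OF integrable_indicator_continuous[OF assms]] by simp

definition phase_mass :: "real set \<Rightarrow> real \<Rightarrow> real \<Rightarrow> real" where
  "phase_mass X s t = measure lebesgue ({s..t} \<inter> X)"

lemma phase_mass_integral:
  assumes "X \<in> sets lebesgue"
  shows "indicat_real X integrable_on {s..t}" "integral {s..t} (indicat_real X) = phase_mass X s t"
proof -
  have "(\<lambda>x. indicator X x *\<^sub>R (1::real)) integrable_on {s..t}"
    by (intro indicator_continuous_integrable_on assms) auto
  then show "indicat_real X integrable_on {s..t}"
    by simp
  have "X \<inter> {s..t} \<in> lmeasurable"
    using assms by (metis Int_commute fmeasurable_Int_fmeasurable lmeasurable_cbox box_real(2))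
  then show "integral {s..t} (indicat_real X) = phase_mass X s t"
    by (simp add: integral_indicator phase_mass_def Int_commute)
qed

lemma phase_mass_nonneg: "0 \<le> phase_mass X s t"
  by (simp add: phase_mass_def)

lemma phase_mass_le_length:
  assumes "X \<in> sets lebesgue" "s \<le> t"
  shows "phase_mass X s t \<le> t - s"
proof -
  have "phase_mass X s t \<le> integral {s..t} (\<lambda>_. 1)"
    unfolding phase_mass_integral(2)[OF assms(1), symmetric]
    by (rule integral_le) (use phase_mass_integral(1)[OF assms(1)] in \<open>auto simp: indicator_def\<close>)
  then show ?thesis
    using assms by simp
qed

text \<open>The integrated form of \<open>u' = \<alpha> \<chi>\<^bsub>X2\<^esub> w\<close>, \<open>w' = \<beta> \<chi>\<^bsub>X1\<^esub> u\<close>. A column of the monodromy matrix solves it with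
  \<open>\<alpha> = z\<close>, \<open>\<beta> = - z\<close>.\<close>

definition two_phase_solution ::
  "real set \<Rightarrow> real set \<Rightarrow> real \<Rightarrow> 'a::{real_normed_field,euclidean_space} \<Rightarrow> 'a \<Rightarrow> (real \<Rightarrow> 'a) \<Rightarrow> (real \<Rightarrow> 'a) \<Rightarrow> bool"
  where "two_phase_solution X1 X2 L \<alpha> \<beta> u w \<longleftrightarrow>
    X1 \<in> sets lebesgue \<and> X2 \<in> sets lebesgue \<and> continuous_on {0..L} u \<and> continuous_on {0..L} w \<and>
    (\<forall>s t. 0 \<le> s \<and> s \<le> t \<and> t \<le> L \<longrightarrow>
      u t = u s + \<alpha> * integral {s..t} (\<lambda>x. indicator X2 x *\<^sub>R w x) \<and>
      w t = w s + \<beta> * integral {s..t} (\<lambda>x. indicator X1 x *\<^sub>R u x))"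

lemma two_phase_solutionD:
  assumes "two_phase_solution X1 X2 L \<alpha> \<beta> u w" "0 \<le> s" "s \<le> t" "t \<le> L"
  shows "u t = u s + \<alpha> * integral {s..t} (\<lambda>x. indicator X2 x *\<^sub>R w x)"
    "w t = w s + \<beta> * integral {s..t} (\<lambda>x. indicator X1 x *\<^sub>R u x)"
  using assms unfolding two_phase_solution_def by blast+

lemma norm_integral_indicator_le:
  fixes f :: "real \<Rightarrow> 'a::euclidean_space"
  assumes X: "X \<in> sets lebesgue" and f: "continuous_on {s..t} f"
  shows "norm (integral {s..t} (\<lambda>x. indicator X x *\<^sub>R f x))
    \<le> integral {s..t} (\<lambda>x. indicator X x * norm (f x))"
proof (rule integral_norm_bound_integral)
  show "(\<lambda>x. indicator X x * norm (f x)) integrable_on {s..t}"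
    using indicator_continuous_integrable_on[OF X continuous_on_norm[OF f]] by simp
qed (use indicator_continuous_integrable_on[OF X f] in \<open>auto simp: indicator_def\<close>)

text \<open>Only inequalities are assumed, so that this covers both the moduli of a complex solution
  and the negative parts of a real one.\<close>

lemma two_phase_gronwall:
  fixes f g :: "real \<Rightarrow> real"
  assumes X: "X1 \<in> sets lebesgue" "X2 \<in> sets lebesgue"
    and "a \<le> b" "0 < c" "0 \<le> R"
    and cont: "continuous_on {a..b} f" "continuous_on {a..b} g"
    and nonneg: "\<And>x. 0 \<le> f x" "\<And>x. 0 \<le> g x"
    and f: "\<And>s t. \<lbrakk>a \<le> s; s \<le> t; t \<le> b\<rbrakk> \<Longrightarrow> f t \<le> f s + R * integral {s..t} (\<lambda>x. indicator X2 x * g x)"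
    and g: "\<And>s t. \<lbrakk>a \<le> s; s \<le> t; t \<le> b\<rbrakk> \<Longrightarrow> g t \<le> g s + R * integral {s..t} (\<lambda>x. indicator X1 x * f x)"
  shows "f b + c * g b
    \<le> (f a + c * g a) * exp (2 * (R * (c * phase_mass X1 a b + phase_mass X2 a b / c)))"
proof -
  define p where "p x = f x + c * g x" for x
  \<comment> \<open>The rate comes from \<open>g \<le> p / c\<close> and \<open>f \<le> p\<close>:
    the \<open>X2\<close> term costs R p / c, and the \<open>X1\<close> term, which enters with
    weight \<open>c\<close>, costs R c p.\<close>
  define k where "k x = R * (c * indicator X1 x + indicator X2 x / c)" for x
  have p_cont: "continuous_on {a..b} p"
    unfolding p_def by (intro continuous_intros cont)
  have int: "(\<lambda>x. indicat_real X x * h x) integrable_on {s..t}"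
    if "X \<in> sets lebesgue" "continuous_on {a..b} h" "a \<le> s" "t \<le> b" for X h s t
    using indicator_continuous_integrable_on[of X s t h] that
    by (simp add: continuous_on_subset)
  have kp: "k x * p x = (R * c) * (indicator X1 x * p x) + (R / c) * (indicator X2 x * p x)" for x
    by (simp add: k_def algebra_simps)
  have kp_int: "(\<lambda>x. k x * p x) integrable_on {s..t}" if "a \<le> s" "t \<le> b" for s t
    unfolding kp by (intro integrable_add integrable_on_mult_right int X p_cont that)
  have "p b \<le> p a * exp (2 * integral {a..b} k)"
  proof (rule gronwall_integral[where B = "R * (c + 1 / c)"])
    show "k integrable_on {a..b}"
      unfolding k_def divide_inverse
      by (intro integrable_on_mult_right integrable_add integrable_on_mult_left phase_mass_integral X)
    show "k x \<le> R * (c + 1 / c)" for x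
      unfolding k_def using \<open>0 < c\<close> \<open>0 \<le> R\<close>
      by (intro mult_left_mono add_mono divide_right_mono mult_left_le) (auto simp: indicator_def)
    fix s t assume st: "a \<le> s" "s \<le> t" "t \<le> b"
    have "p t \<le> p s + (R * integral {s..t} (\<lambda>x. indicator X2 x * g x)
        + c * (R * integral {s..t} (\<lambda>x. indicator X1 x * f x)))"
      unfolding p_def using f[OF st] mult_left_mono[OF g[OF st], of c] \<open>0 < c\<close>
      by (simp add: algebra_simps)
    also have "R * integral {s..t} (\<lambda>x. indicator X2 x * g x)
        + c * (R * integral {s..t} (\<lambda>x. indicator X1 x * f x))
      = integral {s..t} (\<lambda>x. R * (indicator X2 x * g x))
        + integral {s..t} (\<lambda>x. R * c * (indicator X1 x * f x))"
      by (simp only: integral_mult_right mult_ac)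
    also have "\<dots> = integral {s..t} (\<lambda>x. R * (indicator X2 x * g x) + R * c * (indicator X1 x * f x))"
      by (rule Henstock_Kurzweil_Integration.integral_add[symmetric];
          intro integrable_on_mult_right int X cont st)
    also have "\<dots> \<le> integral {s..t} (\<lambda>x. k x * p x)"
    proof (rule integral_le)
      show "(\<lambda>x. R * (indicator X2 x * g x) + R * c * (indicator X1 x * f x)) integrable_on {s..t}"
        by (intro integrable_add integrable_on_mult_right int X cont st)
      fix x
      have "g x \<le> p x / c" "f x \<le> p x"
        using nonneg[of x] \<open>0 < c\<close> by (auto simp: p_def field_simps)
      then have "R * (indicator X2 x * g x) + R * c * (indicator X1 x * f x)
        \<le> R * (indicator X2 x * (p x / c)) + R * c * (indicator X1 x * p x)"
        using \<open>0 < c\<close> \<open>0 \<le> R\<close> by (intro add_mono mult_left_mono) auto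
      then show "R * (indicator X2 x * g x) + R * c * (indicator X1 x * f x) \<le> k x * p x"
        by (simp add: kp)
    qed (use kp_int st in auto)
    finally show "p t \<le> p s + integral {s..t} (\<lambda>x. k x * p x)"
      by simp
  qed (use assms p_cont kp_int in \<open>auto simp: p_def k_def\<close>)
  also have "integral {a..b} k = R * (c * phase_mass X1 a b + phase_mass X2 a b / c)"
    unfolding k_def phase_mass_integral(2)[OF X(1), symmetric] phase_mass_integral(2)[OF X(2), symmetric]
      divide_inverse
    by (subst integral_mult_right, subst Henstock_Kurzweil_Integration.integral_add)
      (auto intro!: integrable_on_mult_right integrable_on_mult_left phase_mass_integral X)
  finally show ?thesis
    by (simp add: p_def)
qed

section \<open>Growth across a single interval\<close>

text \<open>By the AM-GM inequality the best weight is sqrt(m2/m1), with value 2 sqrt(m1 m2). If it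
  lies outside [1/R, R], one mass is at most R^-2 times the other; the truncated weight then makes
  one term at most R sqrt(m1 m2), and the other is just the larger mass.\<close>

lemma balanced_weight:
  fixes m1 m2 R :: real
  assumes "0 \<le> m1" "0 \<le> m2" "1 \<le> R"
  obtains c where "1 / R \<le> c" "c \<le> R" "R * (c * m1 + m2 / c) \<le> 2 * R * sqrt (m1 * m2) + m1 + m2"
proof -
  have inv: "1 / R \<le> R"
    using assms by (simp add: field_simps) (metis mult_mono' mult_1 zero_le_one)
  have extreme: "R * (R * x) \<le> R * sqrt (x * y)" if "R\<^sup>2 * x \<le> y" "0 \<le> x" for x y
  proof -
    have "(R * x)\<^sup>2 \<le> x * y"
      using mult_left_mono[OF that] by (simp add: power2_eq_square mult_ac)
    then show ?thesis
      using assms by (intro mult_left_mono real_le_rsqrt) auto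
  qed
  \<comment> \<open>A vanishing mass falls under one of the first two cases, so both masses are
    positive in the third.\<close>
  consider "R\<^sup>2 * m1 \<le> m2" | "R\<^sup>2 * m2 \<le> m1" | "m2 < R\<^sup>2 * m1" "m1 < R\<^sup>2 * m2"
    by linarith
  then show ?thesis
  proof cases
    case 1
    have "0 \<le> R * sqrt (m1 * m2)"
      using assms by simp
    moreover have "R * (R * m1 + m2 / R) = R * (R * m1) + m2"
      using assms by (simp add: field_simps)
    ultimately show ?thesis
      using that[of R] extreme[OF 1 assms(1)] assms inv by linarith
  next
    case 2
    have "0 \<le> R * sqrt (m1 * m2)"
      using assms by simp
    moreover have "R * (1 / R * m1 + m2 / (1 / R)) = R * (R * m2) + m1"
      using assms by (simp add: field_simps)
    moreover have "R * (R * m2) \<le> R * sqrt (m1 * m2)"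
      using extreme[OF 2 assms(2)] by (simp only: mult.commute[of m2 m1])
    ultimately show ?thesis
      using assms inv by (intro that[of "1 / R"]) linarith+
  next
    case 3
    then have pos: "0 < m1" "0 < m2"
      using assms by (auto simp: zero_less_mult_iff not_less dest: le_less_trans)
    define c where "c = sqrt m2 / sqrt m1"
    have "c * m1 = sqrt m2 * sqrt m1"
      using pos real_div_sqrt[of m1] by (simp only: c_def times_divide_eq_left flip: times_divide_eq_right)
    moreover have "m2 / c = (m2 / sqrt m2) * sqrt m1"
      by (simp add: c_def)
    ultimately have "R * (c * m1 + m2 / c) = 2 * R * sqrt (m1 * m2)"
      using pos by (simp only: real_div_sqrt less_imp_le) (simp add: real_sqrt_mult)
    moreover have "c \<le> R"
    proof -
      have "m2 / m1 \<le> R\<^sup>2"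
        using pos 3 by (simp add: field_simps)
      then show ?thesis
        using assms by (simp add: c_def real_le_lsqrt flip: real_sqrt_divide)
    qed
    moreover have "1 / R \<le> c"
    proof -
      have "(1 / R)\<^sup>2 \<le> m2 / m1"
        using pos 3 assms by (simp add: field_simps)
      then show ?thesis
        by (simp add: c_def real_le_rsqrt flip: real_sqrt_divide)
    qed
    ultimately show ?thesis
      using that[of c] assms by simp
  qed
qed

text \<open>Since 1/R \<le> c \<le> R, passing to the weighted norm and back costs a factor R each
  way, hence R^2. Upper bounds \<open>m1\<close>, \<open>m2\<close> instead of the exact masses
  allow those of a larger interval to be inserted.\<close>

lemma two_phase_transfer_bound:
  assumes sol: "two_phase_solution X1 X2 L \<alpha> \<beta> u w"
    and R: "norm \<alpha> \<le> R" "norm \<beta> \<le> R" "1 \<le> R"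
    and ab: "0 \<le> a" "a \<le> b" "b \<le> L"
    and m: "phase_mass X1 a b \<le> m1" "phase_mass X2 a b \<le> m2"
  shows "norm (u b) + norm (w b)
    \<le> (norm (u a) + norm (w a)) * (R\<^sup>2 * exp (4 * R * sqrt (m1 * m2) + 2 * (m1 + m2)))"
proof -
  have X: "X1 \<in> sets lebesgue" "X2 \<in> sets lebesgue"
    and cont: "continuous_on {0..L} u" "continuous_on {0..L} w"
    using sol by (auto simp: two_phase_solution_def)
  have "0 \<le> m1" "0 \<le> m2"
    using m phase_mass_nonneg order_trans by blast+
  then obtain c where c: "1 / R \<le> c" "c \<le> R"
    "R * (c * m1 + m2 / c) \<le> 2 * R * sqrt (m1 * m2) + m1 + m2"
    using balanced_weight R(3) by blast
  have "0 < 1 / R"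
    using R(3) by simp
  then have "0 < c"
    using c(1) by linarith
  have step: "norm (f t) \<le> norm (f s) + R * integral {s..t} (\<lambda>x. indicator X x * norm (g x))"
    if "f t = f s + \<gamma> * integral {s..t} (\<lambda>x. indicator X x *\<^sub>R g x)" "norm \<gamma> \<le> R"
      "X \<in> sets lebesgue" "continuous_on {0..L} g" "a \<le> s" "t \<le> b" for f g :: "real \<Rightarrow> 'a" and \<gamma> X s t
  proof -
    have "continuous_on {s..t} g"
      by (rule continuous_on_subset[OF that(4)]) (use that ab in auto)
    then have "norm (\<gamma> * integral {s..t} (\<lambda>x. indicator X x *\<^sub>R g x))
        \<le> R * integral {s..t} (\<lambda>x. indicator X x * norm (g x))"
      unfolding norm_mult using that R(3)
      by (intro mult_mono norm_integral_indicator_le) auto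
    then show ?thesis
      unfolding that(1) by (intro norm_triangle_le) simp
  qed
  have *: "norm (u b) + c * norm (w b) \<le> (norm (u a) + c * norm (w a)) *
      exp (2 * (R * (c * phase_mass X1 a b + phase_mass X2 a b / c)))"
  proof (rule two_phase_gronwall[OF X ab(2) \<open>0 < c\<close>])
    show "continuous_on {a..b} (\<lambda>x. norm (u x))" "continuous_on {a..b} (\<lambda>x. norm (w x))"
      by (intro continuous_on_norm continuous_on_subset[OF cont(1)]
          continuous_on_subset[OF cont(2)]; use ab in auto)+
    fix s t assume "a \<le> s" "s \<le> t" "t \<le> b"
    then have st: "0 \<le> s" "s \<le> t" "t \<le> L" "a \<le> s" "t \<le> b"
      using ab by auto
    show "norm (u t) \<le> norm (u s) + R * integral {s..t} (\<lambda>x. indicator X2 x * norm (w x))"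
      by (rule step[OF two_phase_solutionD(1)[OF sol st(1-3)] R(1) X(2) cont(2) st(4,5)])
    show "norm (w t) \<le> norm (w s) + R * integral {s..t} (\<lambda>x. indicator X1 x * norm (u x))"
      by (rule step[OF two_phase_solutionD(2)[OF sol st(1-3)] R(2) X(1) cont(1) st(4,5)])
  qed (use R in auto)
  have "norm (u b) + norm (w b) \<le> R * (norm (u b) + c * norm (w b))"
  proof -
    have "1 * norm (u b) \<le> R * norm (u b)" "1 * norm (w b) \<le> (R * c) * norm (w b)"
      using R(3) c(1) by (intro mult_right_mono; simp add: field_simps)+
    then show ?thesis
      by (simp add: algebra_simps)
  qed
  also have "\<dots> \<le> R * ((norm (u a) + c * norm (w a)) *
      exp (2 * (R * (c * phase_mass X1 a b + phase_mass X2 a b / c))))"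
    using * R(3) by (intro mult_left_mono) auto
  also have "\<dots> \<le> R * ((R * (norm (u a) + norm (w a))) *
      exp (4 * R * sqrt (m1 * m2) + 2 * (m1 + m2)))"
  proof -
    have weight: "norm (u a) + c * norm (w a) \<le> R * (norm (u a) + norm (w a))"
      using mult_right_mono[OF R(3), of "norm (u a)"] mult_right_mono[OF c(2), of "norm (w a)"]
      by (simp add: algebra_simps)
    have mass: "R * (c * phase_mass X1 a b + phase_mass X2 a b / c) \<le> R * (c * m1 + m2 / c)"
      using m R(3) \<open>0 < c\<close> by (intro mult_left_mono add_mono divide_right_mono) auto
    have "2 * (R * (c * phase_mass X1 a b + phase_mass X2 a b / c))
        \<le> 4 * R * sqrt (m1 * m2) + 2 * (m1 + m2)"
    proof -
      have "4 * R * sqrt (m1 * m2) + 2 * (m1 + m2) = 2 * (2 * R * sqrt (m1 * m2) + m1 + m2)"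
        by simp
      then show ?thesis
        using order_trans[OF mass c(3)]
        by (simp only:) (rule mult_left_mono, auto)
    qed
    then show ?thesis
      using weight R(3) by (intro mult_left_mono mult_mono exp_le_cancel_iff[THEN iffD2]) auto
  qed
  finally show ?thesis
    by (simp add: power2_eq_square mult_ac)
qed

section \<open>Multiplying the growth bounds over a covering\<close>

lemma lmeasurable_interval_Int:
  fixes \<omega> :: "real set"
  assumes "is_interval \<omega>" "X \<in> sets lebesgue" "X \<subseteq> {0..L}"
  shows "\<omega> \<inter> X \<in> lmeasurable"
proof -
  have "\<omega> \<inter> {0..L} \<in> lmeasurable"
    using assms by (intro measurable_convex convex_Int is_interval_convex bounded_Int) auto
  then have "(\<omega> \<inter> {0..L}) \<inter> X \<in> lmeasurable"
    using assms(2) by (rule fmeasurable_Int_fmeasurable)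
  then show ?thesis
    using assms(3) by (simp add: Int_assoc Int_absorb1)
qed

text \<open>The endpoints form a null set, so inclusion of the open interval suffices; it is all
  that holds when only the closure of \<open>\<omega>\<close> contains [l, t].\<close>

lemma phase_mass_le_measure_interval:
  fixes \<omega> :: "real set"
  assumes "is_interval \<omega>" "X \<in> sets lebesgue" "X \<subseteq> {0..L}" "{l<..<t} \<subseteq> \<omega>"
  shows "phase_mass X l t \<le> measure lebesgue (\<omega> \<inter> X)"
proof -
  have \<omega>: "\<omega> \<inter> X \<in> lmeasurable"
    by (rule lmeasurable_interval_Int) (use assms in auto)
  have pts: "{l, t} \<in> lmeasurable" "measure lebesgue {l, t} = 0"
    using negligible_imp_measurable[of "{l, t}"] negligible_imp_measure0[of "{l, t}"] by simp_all
  have "phase_mass X l t \<le> measure lebesgue (\<omega> \<inter> X \<union> {l, t})"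
    unfolding phase_mass_def
  proof (rule measure_mono_fmeasurable)
    show "{l..t} \<inter> X \<subseteq> \<omega> \<inter> X \<union> {l, t}"
      using assms(4) by (auto simp: subset_iff less_le)
    show "\<omega> \<inter> X \<union> {l, t} \<in> lmeasurable"
      by (rule fmeasurable.Un[OF \<omega> pts(1)])
  qed (use assms(2) in auto)
  also have "\<dots> \<le> measure lebesgue (\<omega> \<inter> X) + measure lebesgue {l, t}"
    using \<omega> pts by (intro measure_Un_le) auto
  finally show ?thesis
    using pts by simp
qed

text \<open>Induction on the number of intervals: peel off one whose closure contains the right
  endpoint \<open>t\<close>; the remaining ones cover everything to the left of it.\<close>

lemma two_phase_covering_bound:
  fixes \<omega> :: "nat \<Rightarrow> real set"
  assumes sol: "two_phase_solution X1 X2 L \<alpha> \<beta> u w"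
    and R: "norm \<alpha> \<le> R" "norm \<beta> \<le> R" "1 \<le> R"
    and X: "X1 \<subseteq> {0..L}" "X2 \<subseteq> {0..L}"
    and "finite F" "\<And>j. j \<in> F \<Longrightarrow> is_interval (\<omega> j)"
    and "0 \<le> t" "t \<le> L" "{0<..<t} \<subseteq> (\<Union>j\<in>F. \<omega> j)"
  defines "K \<equiv> (\<lambda>j. R\<^sup>2 * exp (4 * R * sqrt (measure lebesgue (\<omega> j \<inter> X1) * measure lebesgue (\<omega> j \<inter> X2)) + 4 * L))"
  shows "norm (u t) + norm (w t) \<le> (norm (u 0) + norm (w 0)) * (\<Prod>j\<in>F. K j)"
  using assms(7-11)
proof (induction "card F" arbitrary: F t)
  case 0
  then have "F = {}" by simp
  then have "t = 0"
    using 0 by (auto simp: not_less)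
  then show ?case
    using \<open>F = {}\<close> by simp
next
  case (Suc n)
  have Xm: "X1 \<in> sets lebesgue" "X2 \<in> sets lebesgue"
    using sol by (auto simp: two_phase_solution_def)
  have K_ge_1: "1 \<le> K j" for j
  proof -
    have "1 * 1 \<le> K j"
      unfolding K_def using R(3) Suc.prems by (intro mult_mono) (auto simp: one_le_power)
    then show ?thesis by simp
  qed
  show ?case
  proof (cases "t = 0")
    case True
    \<comment> \<open>At t = 0 nothing is left to cover although \<open>F\<close> is nonempty; the
      surplus factors are at least 1.\<close>
    have "(norm (u t) + norm (w t)) * 1 \<le> (norm (u t) + norm (w t)) * (\<Prod>j\<in>F. K j)"
      using K_ge_1 by (intro mult_left_mono prod_ge_1) auto
    then show ?thesis
      using True by simp
  next
    case False
    \<comment> \<open>A finite union of closures is closed, so it contains the limit point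
      \<open>t\<close> of the covered interval, even if \<open>t\<close> itself is
      uncovered.\<close>
    then have "t \<in> closure {0<..<t}"
      using Suc.prems by simp
    also have "\<dots> \<subseteq> (\<Union>j\<in>F. closure (\<omega> j))"
    proof (rule closure_minimal)
      show "{0<..<t} \<subseteq> (\<Union>j\<in>F. closure (\<omega> j))"
        by (rule order_trans[OF Suc.prems(5)]) (intro UN_mono closure_subset order_refl)
    qed (use Suc.prems(1) in auto)
    finally obtain j where j: "j \<in> F" "t \<in> closure (\<omega> j)"
      by blast
    define A where "A = closure (\<omega> j) \<inter> {0..t}"
    have "compact A" "A \<noteq> {}"
      using j Suc.prems by (auto simp: A_def intro: closed_Int_compact)
    \<comment> \<open>As \<open>l\<close> is the leftmost point of the closure in [0, t], no point
      of \<open>\<omega> j\<close> lies in (0, l), and the other intervals must cover it.\<close>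
    then obtain l where l: "l \<in> A" "\<And>x. x \<in> A \<Longrightarrow> l \<le> x"
      using continuous_attains_inf[of A "\<lambda>x. x"] by auto
    have l0: "0 \<le> l" "l \<le> t" "l \<in> closure (\<omega> j)"
      using l by (auto simp: A_def)
    have conv: "convex (\<omega> j)"
      using Suc.prems j by (simp add: is_interval_convex)
    have "{l..t} \<subseteq> closure (\<omega> j)"
      using closed_segment_subset[OF l0(3) j(2) convex_closure[OF conv]] l0
      by (simp add: closed_segment_eq_real_ivl)
    \<comment> \<open>A convex set has the same interior as its closure.\<close>
    then have "{l<..<t} \<subseteq> \<omega> j"
      using interior_mono[of "{l..t}" "closure (\<omega> j)"] convex_interior_closure[OF conv]
        interior_subset[of "\<omega> j"] by simp
    then have "phase_mass X1 l t \<le> measure lebesgue (\<omega> j \<inter> X1)"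
      "phase_mass X2 l t \<le> measure lebesgue (\<omega> j \<inter> X2)"
      using Suc.prems j Xm X by (auto intro: phase_mass_le_measure_interval)
    then have "norm (u t) + norm (w t) \<le> (norm (u l) + norm (w l)) *
      (R\<^sup>2 * exp (4 * R * sqrt (measure lebesgue (\<omega> j \<inter> X1) * measure lebesgue (\<omega> j \<inter> X2))
        + 2 * (measure lebesgue (\<omega> j \<inter> X1) + measure lebesgue (\<omega> j \<inter> X2))))"
      using l0 Suc.prems by (intro two_phase_transfer_bound[OF sol R]) auto
    also have "\<dots> \<le> (norm (u l) + norm (w l)) * K j"
    proof -
      \<comment> \<open>Each mass is at most L, so 2(m1 + m2) \<le> 4 L, which is the constant in
        \<open>K\<close>.\<close>
      have "measure lebesgue (\<omega> j \<inter> X) \<le> L" if "X \<in> sets lebesgue" "X \<subseteq> {0..L}" for X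
      proof -
        have "measure lebesgue (\<omega> j \<inter> X) \<le> measure lebesgue {0..L}"
          using that Suc.prems j by (intro measure_mono_fmeasurable)
            (auto intro!: fmeasurableD lmeasurable_interval_Int)
        then show ?thesis
          using Suc.prems by simp
      qed
      from this[OF Xm(1) X(1)] this[OF Xm(2) X(2)] show ?thesis
        unfolding K_def using R by (intro mult_left_mono) auto
    qed
    also have "norm (u l) + norm (w l) \<le> (norm (u 0) + norm (w 0)) * (\<Prod>j\<in>F - {j}. K j)"
    proof (rule Suc.hyps(1))
      show "n = card (F - {j})"
        using Suc.hyps(2) Suc.prems(1) j by simp
      show "{0<..<l} \<subseteq> (\<Union>i\<in>F - {j}. \<omega> i)"
      proof
        fix x assume x: "x \<in> {0<..<l}"
        then have "x \<in> (\<Union>i\<in>F. \<omega> i)"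
          using Suc.prems l0 by force
        moreover have "x \<notin> \<omega> j"
        proof
          assume "x \<in> \<omega> j"
          then have "x \<in> A"
            using x l0 closure_subset[of "\<omega> j"] by (auto simp: A_def)
          then show False
            using l x by fastforce
        qed
        ultimately show "x \<in> (\<Union>i\<in>F - {j}. \<omega> i)"
          by blast
      qed
    qed (use Suc.prems l0 in auto)
    finally show ?thesis
      using K_ge_1[of j] Suc.prems j by (simp add: prod.remove mult_ac mult_right_mono)
  qed
qed

subsection \<open>Growth order\<close>

text \<open>The factor \<open>2 * ln R + K\<close> adds only a term of size ln ln R to the iterated
  logarithm, so its quotient by ln R still tends to d. This is why the logarithmic loss in the upper
  bound does not change the order.\<close>

lemma growth_order_le:
  assumes "0 < C" "0 < d" "0 < K"
    and bound: "\<forall>\<^sub>F R in at_top. \<forall>z. cmod z = R \<longrightarrow> cmod (f z) \<le> exp (C * R powr d * (2 * ln R + K))"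
  shows "growth_order f \<le> ereal d"
proof -
  define B where "B R = C * R powr d * (2 * ln R + K)" for R
  \<comment> \<open>This absorbs the truncation at 1 inside the outer logarithm.\<close>
  have B_ge_1: "\<forall>\<^sub>F R in at_top. 1 \<le> B R"
    unfolding B_def using assms(1-3) by real_asymp
  have lim: "((\<lambda>R. ln (B R) / ln R) \<longlongrightarrow> d) at_top"
    unfolding B_def using assms(1-3) by real_asymp
  have norm_lim: "filterlim cmod at_top at_infinity"
    by (rule filterlim_norm_at_top)
  have "\<forall>\<^sub>F R in at_top. \<forall>z. cmod z = R \<longrightarrow>
      ln (max 1 (ln (max 1 (cmod (f z))))) / ln (cmod z) \<le> ln (B R) / ln R"
    using bound B_ge_1 eventually_gt_at_top[of 1]
  proof eventually_elim
    case (elim R)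
    show ?case
    proof (intro allI impI)
      fix z :: complex
      assume z: "cmod z = R"
      then have "cmod (f z) \<le> exp (B R)"
        using elim by (simp add: B_def)
      then have "ln (max 1 (cmod (f z))) \<le> B R"
        using elim ln_le_cancel_iff[of "max 1 (cmod (f z))" "exp (B R)"] by simp
      then have "ln (max 1 (ln (max 1 (cmod (f z))))) \<le> ln (B R)"
        using elim by simp
      then show "ln (max 1 (ln (max 1 (cmod (f z))))) / ln (cmod z) \<le> ln (B R) / ln R"
        using elim z by (simp add: divide_right_mono)
    qed
  qed
  from norm_lim[unfolded filterlim_iff, rule_format, OF this]
  have "\<forall>\<^sub>F z in at_infinity. ln (max 1 (ln (max 1 (cmod (f z))))) / ln (cmod z)
      \<le> ln (B (cmod z)) / ln (cmod z)"
    by (auto elim: eventually_mono)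
  then have "growth_order f \<le> Limsup at_infinity (\<lambda>z. ereal (ln (B (cmod z)) / ln (cmod z)))"
    unfolding growth_order_def by (intro Limsup_mono) (auto elim: eventually_mono)
  also have "\<dots> = ereal d"
  proof (rule lim_imp_Limsup)
    show "((\<lambda>z. ereal (ln (B (cmod z)) / ln (cmod z))) \<longlongrightarrow> ereal d) at_infinity"
      using filterlim_compose[OF lim norm_lim] by simp
  qed (simp add: trivial_limit_at_infinity)
  finally show ?thesis .
qed

text \<open>Because the limsup is strictly below d, the quotient itself is below d far out, so there
  is no loss in the exponent; dropping the truncations only weakens the bound.\<close>

lemma growth_order_lessD:
  assumes "growth_order f < ereal d"
  shows "\<forall>\<^sub>F z in at_infinity. cmod (f z) \<le> exp (cmod z powr d)"
proof -
  have "\<forall>\<^sub>F z in at_infinity. ereal (ln (max 1 (ln (max 1 (cmod (f z))))) / ln (cmod z)) < ereal d"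
    using assms unfolding growth_order_def by (rule Limsup_lessD)
  moreover have "\<forall>\<^sub>F z in at_infinity. 1 < cmod z"
    using filterlim_norm_at_top[where 'a = complex] eventually_gt_at_top[of 1]
    unfolding filterlim_iff by blast
  ultimately show ?thesis
  proof eventually_elim
    case (elim z)
    define m where "m = max 1 (cmod (f z))"
    have "ln (max 1 (ln m)) < d * ln (cmod z)"
      using elim pos_divide_less_eq[OF ln_gt_zero[OF elim(2)]] by (simp add: m_def)
    moreover have "cmod z powr d = exp (d * ln (cmod z))"
      using elim by (auto simp: powr_def)
    moreover have "exp (ln (max 1 (ln m))) = max 1 (ln m)"
      by (rule exp_ln) simp
    ultimately have "max 1 (ln m) < cmod z powr d"
      by (metis exp_less_cancel_iff)
    then have "ln m < cmod z powr d"
      by simp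
    then have "exp (ln m) < exp (cmod z powr d)"
      by simp
    then show ?case
      by (simp add: m_def)
  qed
qed

text \<open>The truncated quotient is nonnegative wherever |z| > 1. This later forces every exponent
  above the order to be positive.\<close>

lemma growth_order_nonneg: "0 \<le> growth_order f"
proof -
  have "\<forall>\<^sub>F z :: complex in at_infinity. 1 < cmod z"
    using filterlim_norm_at_top[where 'a = complex] eventually_gt_at_top[of 1]
    unfolding filterlim_iff by blast
  then have "Limsup (at_infinity :: complex filter) (\<lambda>_. 0) \<le> growth_order f"
    unfolding growth_order_def by (intro Limsup_mono) (auto elim!: eventually_mono)
  then show ?thesis
    by (simp add: Limsup_const trivial_limit_at_infinity)
qed

section \<open>The upper bound on the order\<close>

text \<open>The factors R^2 exp(4 R a_j + 4 L) of the n covering intervals multiply to the exponent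
  2 n ln R + 4 R (sum of a_j) + 4 L n. By (A) and (B), both R times the sum and n are at most C
  R^d.\<close>

lemma two_phase_growth_order_le:
  fixes u w :: "complex \<Rightarrow> real \<Rightarrow> complex"
  assumes sol: "\<And>z. two_phase_solution X1 X2 L z (- z) (u z) (w z)"
    and init: "\<And>z. cmod (u z 0) + cmod (w z 0) = 1"
    and X: "X1 \<subseteq> {0..L}" "X2 \<subseteq> {0..L}" and "0 \<le> L" "0 < d"
    and adm: "admissible_exponent X1 X2 L d"
  shows "growth_order (\<lambda>z. u z L) \<le> ereal d" "growth_order (\<lambda>z. w z L) \<le> ereal d"
proof -
  obtain C where C: "0 < C" and ev: "\<forall>\<^sub>F R in at_top. \<exists>(n::nat) (\<omega> :: nat \<Rightarrow> real set).
      (\<forall>j<n. is_interval (\<omega> j)) \<and> {0<..<L} \<subseteq> (\<Union>j<n. \<omega> j) \<and>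
      (\<Sum>j<n. sqrt (measure lebesgue (\<omega> j \<inter> X1) * measure lebesgue (\<omega> j \<inter> X2)))
        \<le> C * R powr (d - 1) \<and> real n \<le> C * R powr d"
    using adm unfolding admissible_exponent_def by blast
  have bound: "\<forall>\<^sub>F R in at_top. \<forall>z. cmod z = R \<longrightarrow>
      cmod (u z L) + cmod (w z L) \<le> exp (C * R powr d * (2 * ln R + (4 + 4 * L)))"
    using ev eventually_ge_at_top[of 1]
  proof eventually_elim
    case (elim R)
    then obtain n :: nat and \<omega> where \<omega>: "\<And>j. j < n \<Longrightarrow> is_interval (\<omega> j)" "{0<..<L} \<subseteq> (\<Union>j<n. \<omega> j)"
      and sum: "(\<Sum>j<n. sqrt (measure lebesgue (\<omega> j \<inter> X1) * measure lebesgue (\<omega> j \<inter> X2))) \<le> C * R powr (d - 1)"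
      and n: "real n \<le> C * R powr d"
      by blast
    define a where "a j = sqrt (measure lebesgue (\<omega> j \<inter> X1) * measure lebesgue (\<omega> j \<inter> X2))" for j
    have "2 * real n * ln R + (4 * R * (\<Sum>j<n. a j) + 4 * L * n)
      \<le> 2 * (C * R powr d) * ln R + (4 * R * (C * R powr (d - 1)) + 4 * L * (C * R powr d))"
      using n sum elim \<open>0 \<le> L\<close> unfolding a_def
      by (intro add_mono mult_left_mono mult_right_mono) auto
    also have "\<dots> = C * R powr d * (2 * ln R + (4 + 4 * L))"
      using elim by (simp add: powr_diff field_simps)
    finally have expo: "2 * real n * ln R + (4 * R * (\<Sum>j<n. a j) + 4 * L * n)
      \<le> C * R powr d * (2 * ln R + (4 + 4 * L))" .
    have R2: "R\<^sup>2 = exp (2 * ln R)"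
      using elim by (simp add: exp_double)
    have "(\<Prod>j<n. R\<^sup>2 * exp (4 * R * a j + 4 * L)) = (\<Prod>j<n. exp (2 * ln R + (4 * R * a j + 4 * L)))"
      by (simp only: R2 exp_add)
    also have "\<dots> = exp (\<Sum>j<n. 2 * ln R + (4 * R * a j + 4 * L))"
      by (simp add: exp_sum)
    also have "(\<Sum>j<n. 2 * ln R + (4 * R * a j + 4 * L)) = 2 * real n * ln R + (4 * R * (\<Sum>j<n. a j) + 4 * L * n)"
      by (simp add: sum.distrib sum_distrib_left)
    finally have prod: "(\<Prod>j<n. R\<^sup>2 * exp (4 * R * a j + 4 * L)) \<le> exp (C * R powr d * (2 * ln R + (4 + 4 * L)))"
      using expo by simp
    show ?case
    proof (intro allI impI)
      fix z assume z: "cmod z = R"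
      have "cmod (u z L) + cmod (w z L) \<le> (cmod (u z 0) + cmod (w z 0)) *
          (\<Prod>j\<in>{..<n}. R\<^sup>2 * exp (4 * R * sqrt (measure lebesgue (\<omega> j \<inter> X1) * measure lebesgue (\<omega> j \<inter> X2)) + 4 * L))"
        by (rule two_phase_covering_bound[OF sol])
          (use z elim X \<omega> \<open>0 \<le> L\<close> in auto)
      then show "cmod (u z L) + cmod (w z L) \<le> exp (C * R powr d * (2 * ln R + (4 + 4 * L)))"
        using prod by (simp add: init a_def)
    qed
  qed
  have "0 < 4 + 4 * L"
    using \<open>0 \<le> L\<close> by simp
  note le = growth_order_le[OF C \<open>0 < d\<close> this]
  show "growth_order (\<lambda>z. u z L) \<le> ereal d" "growth_order (\<lambda>z. w z L) \<le> ereal d"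
    by (rule le, rule eventually_mono[OF bound], smt (verit) norm_ge_zero)+
qed

subsection \<open>Greedy coverings\<close>

text \<open>The negative parts of \<open>u\<close> and \<open>w\<close> satisfy the Gronwall
  hypotheses with \<open>c = 1\<close> and start from 0, so they vanish.\<close>

lemma two_phase_nonneg:
  fixes u w :: "real \<Rightarrow> real"
  assumes sol: "two_phase_solution X1 X2 L R R u w"
    and "0 \<le> R" "0 \<le> u 0" "0 \<le> w 0" "0 \<le> x" "x \<le> L"
  shows "0 \<le> u x" "0 \<le> w x"
proof -
  have X: "X1 \<in> sets lebesgue" "X2 \<in> sets lebesgue"
    and cont: "continuous_on {0..L} u" "continuous_on {0..L} w"
    using sol by (auto simp: two_phase_solution_def)
  have neg: "max 0 (- f t) \<le> max 0 (- f s) + R * integral {s..t} (\<lambda>x. indicator X x * max 0 (- g x))"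
    if "f t = f s + R * integral {s..t} (\<lambda>x. indicator X x *\<^sub>R g x)"
      "X \<in> sets lebesgue" "continuous_on {0..L} g" "0 \<le> s" "t \<le> L" for f g :: "real \<Rightarrow> real" and X s t
  proof -
    have g: "continuous_on {s..t} g"
      by (rule continuous_on_subset[OF that(3)]) (use that in auto)
    have int: "(\<lambda>x. indicator X x * max 0 (- g x)) integrable_on {s..t}"
      using indicator_continuous_integrable_on[OF that(2), of s t "\<lambda>x. max 0 (- g x)"] g
      by (simp add: continuous_intros)
    have int': "(\<lambda>x. - (indicator X x * g x)) integrable_on {s..t}"
      using integrable_neg[OF indicator_continuous_integrable_on[OF that(2) g]] by simp
    have "- integral {s..t} (\<lambda>x. indicator X x * g x) \<le> integral {s..t} (\<lambda>x. indicator X x * max 0 (- g x))"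
      unfolding Henstock_Kurzweil_Integration.integral_neg[symmetric]
      by (rule integral_le[OF int' int]) (auto simp: indicator_def)
    from mult_left_mono[OF this \<open>0 \<le> R\<close>]
    have "- f t \<le> - f s + R * integral {s..t} (\<lambda>x. indicator X x * max 0 (- g x))"
      unfolding that(1) by simp
    moreover have "0 \<le> R * integral {s..t} (\<lambda>x. indicator X x * max 0 (- g x))"
      using \<open>0 \<le> R\<close> by (intro mult_nonneg_nonneg integral_nonneg int) auto
    ultimately show ?thesis
      by linarith
  qed
  have "max 0 (- u x) + 1 * max 0 (- w x) \<le> (max 0 (- u 0) + 1 * max 0 (- w 0)) *
      exp (2 * (R * (1 * phase_mass X1 0 x + phase_mass X2 0 x / 1)))"
  proof (rule two_phase_gronwall[OF X \<open>0 \<le> x\<close> zero_less_one \<open>0 \<le> R\<close>])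
    show "continuous_on {0..x} (\<lambda>x. max 0 (- u x))" "continuous_on {0..x} (\<lambda>x. max 0 (- w x))"
      by (intro continuous_intros continuous_on_subset[OF cont(1)]
          continuous_on_subset[OF cont(2)]; use assms in auto)+
    fix s t assume "0 \<le> s" "s \<le> t" "t \<le> x"
    then have st: "0 \<le> s" "s \<le> t" "t \<le> L"
      using assms by auto
    show "max 0 (- u t) \<le> max 0 (- u s) + R * integral {s..t} (\<lambda>x. indicator X2 x * max 0 (- w x))"
      by (rule neg[OF two_phase_solutionD(1)[OF sol st] X(2) cont(2) st(1,3)])
    show "max 0 (- w t) \<le> max 0 (- w s) + R * integral {s..t} (\<lambda>x. indicator X1 x * max 0 (- u x))"
      by (rule neg[OF two_phase_solutionD(2)[OF sol st] X(1) cont(1) st(1,3)])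
  qed auto
  then show "0 \<le> u x" "0 \<le> w x"
    using assms by (auto simp: max_def split: if_splits)
qed

text \<open>By nonnegativity both components increase, so each integrand can be frozen at its value
  at \<open>s\<close> for a lower bound and at its value at \<open>t\<close> for an upper
  one.\<close>

lemma two_phase_increments:
  fixes u w :: "real \<Rightarrow> real"
  assumes sol: "two_phase_solution X1 X2 L R R u w"
    and "0 \<le> R" "0 \<le> u 0" "0 \<le> w 0" and st: "0 \<le> s" "s \<le> t" "t \<le> L"
  shows "u s \<le> u t" "w s \<le> w t"
    and "u s + R * phase_mass X2 s t * w s \<le> u t" "w s + R * phase_mass X1 s t * u s \<le> w t"
    and "u t \<le> u s + R * (t - s) * w t" "w t \<le> w s + R * (t - s) * u t"
proof -
  have X: "X1 \<in> sets lebesgue" "X2 \<in> sets lebesgue"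
    and cont: "continuous_on {0..L} u" "continuous_on {0..L} w"
    using sol by (auto simp: two_phase_solution_def)
  note nonneg = two_phase_nonneg[OF sol assms(2-4)]
  have int: "(\<lambda>x. indicator X x * g x) integrable_on {a..b}"
    if "X \<in> sets lebesgue" "continuous_on {0..L} g" "0 \<le> a" "b \<le> L" for X a b and g :: "real \<Rightarrow> real"
    using indicator_continuous_integrable_on[OF that(1), of a b g] continuous_on_subset[OF that(2), of "{a..b}"] that
    by simp
  have mono: "f a \<le> f b"
    if "f b = f a + R * integral {a..b} (\<lambda>x. indicator X x *\<^sub>R g x)"
      "X \<in> sets lebesgue" "continuous_on {0..L} g" "\<And>x. 0 \<le> x \<Longrightarrow> x \<le> L \<Longrightarrow> 0 \<le> g x" "0 \<le> a" "b \<le> L"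
    for f g X a b
  proof -
    have "0 \<le> integral {a..b} (\<lambda>x. indicator X x * g x)"
      by (rule integral_nonneg[OF int]) (use that in auto)
    with \<open>0 \<le> R\<close> show ?thesis
      unfolding that(1) by simp
  qed
  have u_mono: "u a \<le> u b" if "0 \<le> a" "a \<le> b" "b \<le> L" for a b
    by (rule mono[OF two_phase_solutionD(1)[OF sol that] X(2) cont(2) nonneg(2) that(1,3)])
  have w_mono: "w a \<le> w b" if "0 \<le> a" "a \<le> b" "b \<le> L" for a b
    by (rule mono[OF two_phase_solutionD(2)[OF sol that] X(1) cont(1) nonneg(1) that(1,3)])
  show "u s \<le> u t" "w s \<le> w t"
    using u_mono w_mono st by auto
  have lower: "f s + R * phase_mass X s t * g s \<le> f t"
    and upper: "f t \<le> f s + R * (t - s) * g t"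
    if "f t = f s + R * integral {s..t} (\<lambda>x. indicator X x *\<^sub>R g x)"
      "X \<in> sets lebesgue" "continuous_on {0..L} g" "\<And>a b. 0 \<le> a \<Longrightarrow> a \<le> b \<Longrightarrow> b \<le> L \<Longrightarrow> g a \<le> g b"
      "0 \<le> g t" for f g X
  proof -
    have const: "integral {s..t} (\<lambda>x. indicator X x * c) = phase_mass X s t * c" for c :: real
      using phase_mass_integral(2)[OF that(2)] by simp
    have "integral {s..t} (\<lambda>x. indicator X x * g s) \<le> integral {s..t} (\<lambda>x. indicator X x * g x)"
      by (rule integral_le) (use that st in \<open>auto intro!: int mult_left_mono\<close>)
    then have "phase_mass X s t * g s \<le> integral {s..t} (\<lambda>x. indicator X x * g x)"
      unfolding const .
    with \<open>0 \<le> R\<close> show "f s + R * phase_mass X s t * g s \<le> f t"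
      unfolding that(1) by (simp add: mult.assoc mult_left_mono)
    have "integral {s..t} (\<lambda>x. indicator X x * g x) \<le> integral {s..t} (\<lambda>x. indicator X x * g t)"
      by (rule integral_le) (use that st in \<open>auto intro!: int mult_left_mono\<close>)
    also have "\<dots> \<le> (t - s) * g t"
      unfolding const using that phase_mass_le_length[OF that(2) st(2)] by (intro mult_right_mono)
    finally show "f t \<le> f s + R * (t - s) * g t"
      unfolding that(1) using \<open>0 \<le> R\<close> by (simp add: mult.assoc mult_left_mono)
  qed
  have t: "0 \<le> u t" "0 \<le> w t"
    using nonneg[of t] st by auto
  show "u s + R * phase_mass X2 s t * w s \<le> u t" "u t \<le> u s + R * (t - s) * w t"
    using lower upper two_phase_solutionD(1)[OF sol st] X(2) cont(2) w_mono t(2) by blast+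
  show "w s + R * phase_mass X1 s t * u s \<le> w t" "w t \<le> w s + R * (t - s) * u t"
    using lower upper two_phase_solutionD(2)[OF sol st] X(1) cont(1) u_mono t(1) by blast+
qed

section \<open>The greedy construction\<close>

text \<open>One greedy step, by the intermediate value theorem: the product is continuous in the
  right endpoint and vanishes at \<open>s\<close>. Either the rest up to L can serve as the last
  interval, or the next interval ends where the product equals \<open>\<epsilon>\<close>.\<close>

lemma phase_mass_product_hits:
  assumes X: "X1 \<in> sets lebesgue" "X2 \<in> sets lebesgue" and "s \<le> L" "0 \<le> \<epsilon>"
  obtains "phase_mass X1 s L * phase_mass X2 s L \<le> \<epsilon>"
  | t where "s \<le> t" "t \<le> L" "phase_mass X1 s t * phase_mass X2 s t = \<epsilon>"
proof (cases "phase_mass X1 s L * phase_mass X2 s L \<le> \<epsilon>")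
  case False
  have "continuous_on {s..L} (\<lambda>t. phase_mass X s t)" if "X \<in> sets lebesgue" for X
    using indefinite_integral_continuous_1[OF phase_mass_integral(1)[OF that]]
    by (simp add: phase_mass_integral(2)[OF that])
  then have "continuous_on {s..L} (\<lambda>t. phase_mass X1 s t * phase_mass X2 s t)"
    by (intro continuous_on_mult) (use X in auto)
  moreover have "phase_mass X1 s s = 0"
    using phase_mass_le_length[OF X(1), of s s] phase_mass_nonneg[of X1 s s] by simp
  ultimately obtain t where "s \<le> t" "t \<le> L" "phase_mass X1 s t * phase_mass X2 s t = \<epsilon>"
    using IVT'[of "\<lambda>t. phase_mass X1 s t * phase_mass X2 s t" s \<epsilon> L] False assms by auto
  then show ?thesis
    using that by blast
qed

text \<open>With \<epsilon> = 1/R^2 every interval contributes at most 1/R to the sum in (A), so (A)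
  reduces to counting intervals. At t = 0 the half-open range is empty, which lets the construction
  start with no interval.\<close>

definition covered_by :: "real set \<Rightarrow> real set \<Rightarrow> real \<Rightarrow> nat \<Rightarrow> real \<Rightarrow> bool" where
  "covered_by X1 X2 \<epsilon> n t \<longleftrightarrow> (\<exists>\<omega> :: nat \<Rightarrow> real set. {0..<t} \<subseteq> (\<Union>j<n. \<omega> j) \<and>
    (\<forall>j<n. is_interval (\<omega> j) \<and> measure lebesgue (\<omega> j \<inter> X1) * measure lebesgue (\<omega> j \<inter> X2) \<le> \<epsilon>))"

lemma covered_by_extend:
  assumes "covered_by X1 X2 \<epsilon> n s" "s \<le> t" "phase_mass X1 s t * phase_mass X2 s t \<le> \<epsilon>"
  shows "covered_by X1 X2 \<epsilon> (Suc n) t"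
proof -
  obtain \<omega> :: "nat \<Rightarrow> real set" where \<omega>: "{0..<s} \<subseteq> (\<Union>j<n. \<omega> j)"
    "\<And>j. j < n \<Longrightarrow> is_interval (\<omega> j) \<and> measure lebesgue (\<omega> j \<inter> X1) * measure lebesgue (\<omega> j \<inter> X2) \<le> \<epsilon>"
    using assms(1) by (auto simp: covered_by_def)
  define \<omega>' where "\<omega>' j = (if j = n then {s..t} else \<omega> j)" for j
  have UN: "(\<Union>j<Suc n. \<omega>' j) = (\<Union>j<n. \<omega> j) \<union> {s..t}"
    by (auto simp: less_Suc_eq \<omega>'_def)
  have "{0..<t} \<subseteq> {0..<s} \<union> {s..t}"
    by auto
  then have "{0..<t} \<subseteq> (\<Union>j<Suc n. \<omega>' j)"
    unfolding UN using \<omega>(1) by blast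
  moreover have "is_interval (\<omega>' j) \<and>
      measure lebesgue (\<omega>' j \<inter> X1) * measure lebesgue (\<omega>' j \<inter> X2) \<le> \<epsilon>"
    if "j < Suc n" for j
    using \<omega>(2) that assms(3) by (auto simp: \<omega>'_def phase_mass_def less_Suc_eq is_interval_cc)
  ultimately show ?thesis
    unfolding covered_by_def by blast
qed

text \<open>Along an interval with masses \<open>m1, m2\<close>, \<open>R\<^sup>2 m1 m2 = 1\<close>, the product \<open>u w\<close> grows at least by
  the factor 4, because \<open>(u + R m2 w) (w + R m1 u) - 4 u w = R m1 (u - R m2 w)\<^sup>2\<close>.\<close>

lemma two_phase_product_growth:
  fixes u w :: "real \<Rightarrow> real"
  assumes sol: "two_phase_solution X1 X2 L R R u w"
    and "0 < R" "0 \<le> u 0" "0 \<le> w 0" and st: "0 \<le> s" "s \<le> t" "t \<le> L"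
    and mass: "phase_mass X1 s t * phase_mass X2 s t = 1 / R\<^sup>2"
  shows "4 * (u s * w s) \<le> u t * w t"
proof -
  \<comment> \<open>Rescaling by R turns the mass condition into \<open>p * q = 1\<close>.\<close>
  define p q where "p = R * phase_mass X2 s t" and "q = R * phase_mass X1 s t"
  have pq: "0 \<le> p" "0 \<le> q" "p * q = 1"
    using mass \<open>0 < R\<close> by (auto simp: p_def q_def phase_mass_nonneg field_simps power2_eq_square)
  have nonneg: "0 \<le> u s" "0 \<le> w s"
    using two_phase_nonneg[OF sol, of s] assms by auto
  have "(u s + p * w s) * (w s + q * u s) - 4 * (u s * w s) = q * (u s - p * w s)\<^sup>2"
  proof -
    \<comment> \<open>The two sides of the claimed identity differ by a multiple of p q - 1, which
      vanishes.\<close>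
    have "(u s + p * w s) * (w s + q * u s) - 4 * (u s * w s) - q * (u s - p * w s)\<^sup>2
        = (p * q - 1) * (3 * (u s * w s) - p * (w s)\<^sup>2)"
      by (simp add: algebra_simps power2_eq_square)
    then show ?thesis
      using pq by simp
  qed
  moreover have "0 \<le> q * (u s - p * w s)\<^sup>2"
    using pq by simp
  moreover have "(u s + p * w s) * (w s + q * u s) \<le> u t * w t"
    using two_phase_increments(3,4)[OF sol _ assms(3,4) st] \<open>0 < R\<close> pq nonneg
    by (intro mult_mono) (auto simp: p_def q_def intro: order_trans[OF _ two_phase_increments(1)[OF sol _ assms(3,4) st]])
  ultimately show ?thesis
    by linarith
qed

text \<open>The product starts at 0, so the factor 4 yields nothing on the first interval. There the
  zero component rises to at least \<open>q\<close> or \<open>p\<close> while the other stays at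
  least 1, and p q = 1 with both at most R L makes each at least 1/(R L).\<close>

lemma two_phase_product_start:
  fixes u w :: "real \<Rightarrow> real"
  assumes sol: "two_phase_solution X1 X2 L R R u w"
    and "0 < R" and init: "u 0 = 1 \<and> w 0 = 0 \<or> u 0 = 0 \<and> w 0 = 1"
    and t: "0 \<le> t" "t \<le> L"
    and mass: "phase_mass X1 0 t * phase_mass X2 0 t = 1 / R\<^sup>2"
  shows "1 / (R * L) \<le> u t * w t"
proof -
  define p q where "p = R * phase_mass X2 0 t" and "q = R * phase_mass X1 0 t"
  have pq: "0 \<le> p" "0 \<le> q" "p * q = 1"
    using mass \<open>0 < R\<close> by (auto simp: p_def q_def phase_mass_nonneg field_simps power2_eq_square)
  then have pos: "0 < p" "0 < q"
    by (auto simp: less_le)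
  have X: "X1 \<in> sets lebesgue" "X2 \<in> sets lebesgue"
    using sol by (auto simp: two_phase_solution_def)
  have "p \<le> R * L" "q \<le> R * L"
    using phase_mass_le_length[OF X(1) t(1)] phase_mass_le_length[OF X(2) t(1)] t \<open>0 < R\<close>
    by (auto simp: p_def q_def)
  moreover have "p = 1 / q" "q = 1 / p"
    using pq pos by (auto simp: field_simps)
  ultimately have ge: "1 / (R * L) \<le> p" "1 / (R * L) \<le> q"
    using pos by (metis frac_le order_refl zero_le_one)+
  have u0: "0 \<le> u 0" "0 \<le> w 0"
    using init by auto
  have "0 \<le> R" using \<open>0 < R\<close> by simp
  note inc = two_phase_increments(3,4)[OF sol this u0 order_refl t]
  from init show ?thesis
  proof
    assume *: "u 0 = 1 \<and> w 0 = 0"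
    then have "1 * q \<le> u t * w t"
      using inc pq by (intro mult_mono) (auto simp: q_def)
    then show ?thesis
      using ge by simp
  next
    assume *: "u 0 = 0 \<and> w 0 = 1"
    then have "p * 1 \<le> u t * w t"
      using inc pq by (intro mult_mono) (auto simp: p_def)
    then show ?thesis
      using ge by simp
  qed
qed

text \<open>The first interval only makes the product positive and each later one multiplies it by
  at least 4; hence k + 1 intervals go with the power 4^k.\<close>

lemma two_phase_greedy_covering:
  fixes u w :: "real \<Rightarrow> real"
  assumes sol: "two_phase_solution X1 X2 L R R u w"
    and "0 < R" "0 \<le> L" and init: "u 0 = 1 \<and> w 0 = 0 \<or> u 0 = 0 \<and> w 0 = 1"
  shows "covered_by X1 X2 (1 / R\<^sup>2) (Suc k) L \<or>
    (\<exists>t\<in>{0..L}. covered_by X1 X2 (1 / R\<^sup>2) (Suc k) t \<and> 4 ^ k / (R * L) \<le> u t * w t)"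
proof (induction k)
  have X: "X1 \<in> sets lebesgue" "X2 \<in> sets lebesgue"
    using sol by (auto simp: two_phase_solution_def)
  have eps: "0 \<le> 1 / R\<^sup>2"
    by simp
  have u0: "0 \<le> u 0" "0 \<le> w 0"
    using init by auto
  {
    case 0
    have "covered_by X1 X2 (1 / R\<^sup>2) 0 0"
      by (simp add: covered_by_def)
    note ext = covered_by_extend[OF this]
    from phase_mass_product_hits[OF X \<open>0 \<le> L\<close> eps] show ?case
    proof cases
      case 1
      then show ?thesis
        using ext \<open>0 \<le> L\<close> by auto
    next
      case (2 t)
      then show ?thesis
        using ext[of t] two_phase_product_start[OF sol \<open>0 < R\<close> init, of t] by auto
    qed
  next
    case (Suc k)
    then consider "covered_by X1 X2 (1 / R\<^sup>2) (Suc k) L"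
      | s where "0 \<le> s" "s \<le> L" "covered_by X1 X2 (1 / R\<^sup>2) (Suc k) s" "4 ^ k / (R * L) \<le> u s * w s"
      by auto
    then show ?case
    proof cases
      case 1
      \<comment> \<open>All of [0, L) is covered already; the degenerate interval [L, L] of mass 0
        is added to raise the count.\<close>
      have "phase_mass X1 L L = 0"
        using phase_mass_le_length[OF X(1), of L L] phase_mass_nonneg[of X1 L L] by simp
      then show ?thesis
        using covered_by_extend[OF 1, of L] by simp
    next
      case (2 s)
      from phase_mass_product_hits[OF X \<open>s \<le> L\<close> eps] show ?thesis
      proof cases
        case 1
        then show ?thesis
          using covered_by_extend[OF 2(3,2)] by simp
      next
        case t: (2 t)
        have "4 * (u s * w s) \<le> u t * w t"
          using two_phase_product_growth[OF sol \<open>0 < R\<close> u0] 2 t by simp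
        then have "4 ^ Suc k / (R * L) \<le> u t * w t"
          using 2(4) by simp
        then show ?thesis
          using covered_by_extend[OF 2(3), of t] 2 t by (intro disjI2 bexI[of _ t]) auto
      qed
    qed
  }
qed

text \<open>If L were not reached, monotonicity would carry the lower bound 4^k/(R L) on
  \<open>u * w\<close> to the endpoint. There a bound \<open>m\<close> on one component bounds the
  other by (1 + R L) m, so a single entry controls the product; this is what makes the order
  independent of the row.\<close>

lemma two_phase_covering_of_growth:
  fixes u w :: "real \<Rightarrow> real"
  assumes sol: "two_phase_solution X1 X2 L R R u w"
    and "0 < R" "0 < L" and init: "u 0 = 1 \<and> w 0 = 0 \<or> u 0 = 0 \<and> w 0 = 1"
    and m: "1 \<le> m" "u L \<le> m \<or> w L \<le> m" and k: "R * L * (1 + R * L) * m\<^sup>2 < 4 ^ k"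
  shows "covered_by X1 X2 (1 / R\<^sup>2) (Suc k) L"
proof (rule ccontr)
  assume "\<not> ?thesis"
  moreover have "0 \<le> L"
    using \<open>0 < L\<close> by simp
  ultimately obtain t where t: "0 \<le> t" "t \<le> L" "4 ^ k / (R * L) \<le> u t * w t"
    using two_phase_greedy_covering[OF sol \<open>0 < R\<close> _ init, of k] by auto
  have u0: "0 \<le> u 0" "0 \<le> w 0" "u 0 \<le> 1" "w 0 \<le> 1"
    using init by auto
  have R: "0 \<le> R" using \<open>0 < R\<close> by simp
  note inc = two_phase_increments[OF sol R u0(1,2)]
  note nonneg = two_phase_nonneg[OF sol R u0(1,2)]
  have L: "0 \<le> u L" "0 \<le> w L" "u L \<le> 1 + R * L * w L" "w L \<le> 1 + R * L * u L"
    using nonneg[of L] inc(5,6)[of 0 L] \<open>0 < L\<close> u0 by auto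
  have "u t * w t \<le> u L * w L"
    using inc(1,2)[of t L] nonneg[of t] nonneg[of L] t \<open>0 < L\<close> by (intro mult_mono) auto
  also have "\<dots> \<le> m * ((1 + R * L) * m)"
  proof -
    have *: "y \<le> (1 + R * L) * m" if "y \<le> 1 + R * L * x" "x \<le> m" for x y
    proof -
      have "R * L * x \<le> R * L * m"
        using that R \<open>0 < L\<close> by (intro mult_left_mono) auto
      then show ?thesis
        using that m by (simp add: distrib_right)
    qed
    from m(2) show ?thesis
    proof
      assume "u L \<le> m"
      then show ?thesis
        using *[OF L(4)] L m by (intro mult_mono) auto
    next
      assume "w L \<le> m"
      then have "w L * u L \<le> m * ((1 + R * L) * m)"
        using *[OF L(3)] L m by (intro mult_mono) auto
      then show ?thesis
        by (simp add: mult.commute)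
    qed
  qed
  finally have "u t * w t \<le> (1 + R * L) * m\<^sup>2"
    by (simp add: power2_eq_square mult_ac)
  with t(3) have "4 ^ k / (R * L) \<le> (1 + R * L) * m\<^sup>2"
    by linarith
  then have "4 ^ k \<le> (1 + R * L) * m\<^sup>2 * (R * L)"
    using \<open>0 < R\<close> \<open>0 < L\<close> by (simp add: pos_divide_le_eq)
  then show False
    using k by (simp add: mult_ac)
qed

text \<open>With m = exp(R^d) the number of greedy intervals is 2 R^d plus a logarithmic term, which
  gives (B); (A) follows since each interval contributes at most 1/R.\<close>

lemma admissible_exponent_of_growth:
  assumes "0 < L" "0 < d"
    and ev: "\<forall>\<^sub>F R in at_top. \<exists>u w :: real \<Rightarrow> real. two_phase_solution X1 X2 L R R u w \<and>
      (u 0 = 1 \<and> w 0 = 0 \<or> u 0 = 0 \<and> w 0 = 1) \<and> (u L \<le> exp (R powr d) \<or> w L \<le> exp (R powr d))"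
  shows "admissible_exponent X1 X2 L d"
  unfolding admissible_exponent_def
proof (intro exI[of _ 3] conjI)
  \<comment> \<open>This absorbs the logarithm, the rounding of \<open>k\<close> and the extra first
    interval into one more R^d, whence the constant 3.\<close>
  have "\<forall>\<^sub>F R in at_top. 2 * ln (1 + R * L) + 2 \<le> R powr d"
    using \<open>0 < L\<close> \<open>0 < d\<close> by real_asymp
  with ev show "\<forall>\<^sub>F R in at_top. \<exists>(n::nat) (\<omega> :: nat \<Rightarrow> real set).
        (\<forall>j<n. is_interval (\<omega> j)) \<and> {0<..<L} \<subseteq> (\<Union>j<n. \<omega> j) \<and>
        (\<Sum>j<n. sqrt (measure lebesgue (\<omega> j \<inter> X1) * measure lebesgue (\<omega> j \<inter> X2)))
          \<le> 3 * R powr (d - 1) \<and>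
        real n \<le> 3 * R powr d"
    using eventually_gt_at_top[of 0]
  proof eventually_elim
    case (elim R)
    then obtain u w :: "real \<Rightarrow> real" where sol: "two_phase_solution X1 X2 L R R u w"
      and init: "u 0 = 1 \<and> w 0 = 0 \<or> u 0 = 0 \<and> w 0 = 1"
      and growth: "u L \<le> exp (R powr d) \<or> w L \<le> exp (R powr d)"
      by blast
    have RL: "0 < R * L"
      using elim \<open>0 < L\<close> by simp
    \<comment> \<open>The logarithm of (1 + R L)^2 m^2 with m = exp(R^d), a bound for the quantity
      that 4^k has to exceed; since e \<le> 4, any k \<ge> y will do.\<close>
    define y where "y = 2 * R powr d + 2 * ln (1 + R * L)"
    have "0 \<le> y"
      unfolding y_def using RL by simp
    define k where "k = nat \<lceil>y\<rceil>"
    have k: "y \<le> real k" "real k \<le> y + 1"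
      using \<open>0 \<le> y\<close> by (auto simp: k_def)
    have "R * L * (1 + R * L) * (exp (R powr d))\<^sup>2 < (1 + R * L)\<^sup>2 * (exp (R powr d))\<^sup>2"
      using RL by (intro mult_strict_right_mono) (auto simp: power2_eq_square intro!: mult_strict_right_mono)
    also have "\<dots> = exp y"
      using RL by (simp add: y_def exp_add exp_double)
    also have "\<dots> \<le> exp (real k)"
      using k by simp
    also have "\<dots> = exp 1 ^ k"
      by (simp flip: exp_of_nat_mult)
    also have "\<dots> \<le> 4 ^ k"
      using exp_le by (intro power_mono) auto
    finally have "R * L * (1 + R * L) * (exp (R powr d))\<^sup>2 < 4 ^ k" .
    with two_phase_covering_of_growth[OF sol elim(3) \<open>0 < L\<close> init _ growth]
    have "covered_by X1 X2 (1 / R\<^sup>2) (Suc k) L"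
      by simp
    then obtain \<omega> :: "nat \<Rightarrow> real set" where \<omega>: "{0..<L} \<subseteq> (\<Union>j<Suc k. \<omega> j)"
      "\<And>j. j < Suc k \<Longrightarrow> is_interval (\<omega> j)"
      "\<And>j. j < Suc k \<Longrightarrow> measure lebesgue (\<omega> j \<inter> X1) * measure lebesgue (\<omega> j \<inter> X2) \<le> 1 / R\<^sup>2"
      by (auto simp: covered_by_def)
    have n: "real (Suc k) \<le> 3 * R powr d"
      using k elim by (simp add: y_def)
    have "(\<Sum>j<Suc k. sqrt (measure lebesgue (\<omega> j \<inter> X1) * measure lebesgue (\<omega> j \<inter> X2))) \<le> (\<Sum>j<Suc k. 1 / R)"
    proof (rule sum_mono)
      fix j assume "j \<in> {..<Suc k}"
      then have "sqrt (measure lebesgue (\<omega> j \<inter> X1) * measure lebesgue (\<omega> j \<inter> X2)) \<le> sqrt (1 / R\<^sup>2)"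
        using \<omega>(3) by (intro real_sqrt_le_mono) auto
      also have "\<dots> = 1 / R"
        using elim by (simp add: real_sqrt_divide)
      finally show "sqrt (measure lebesgue (\<omega> j \<inter> X1) * measure lebesgue (\<omega> j \<inter> X2)) \<le> 1 / R" .
    qed
    also have "\<dots> = real (Suc k) / R"
      by simp
    also have "\<dots> \<le> 3 * R powr d / R"
      using n elim by (intro divide_right_mono) auto
    also have "\<dots> = 3 * R powr (d - 1)"
      using elim by (simp add: powr_diff)
    finally have sum: "(\<Sum>j<Suc k. sqrt (measure lebesgue (\<omega> j \<inter> X1) * measure lebesgue (\<omega> j \<inter> X2)))
        \<le> 3 * R powr (d - 1)" .
    have "{0<..<L} \<subseteq> (\<Union>j<Suc k. \<omega> j)"
      by (rule order_trans[OF _ \<omega>(1)]) auto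
    with sum n \<omega>(2) show ?case
      by (intro exI[of _ "Suc k"] exI[of _ \<omega>]) blast
  qed
qed simp

subsection \<open>The monodromy matrix\<close>

text \<open>At z = iR one has (c u)' = R \<chi>2 (i c w) and (i c w)' = R \<chi>1 (c u). These
  coefficients are real, so real parts may be taken.\<close>

lemma two_phase_solution_Re:
  fixes u w :: "real \<Rightarrow> complex"
  assumes sol: "two_phase_solution X1 X2 L (\<i> * of_real R) (- (\<i> * of_real R)) u w"
  shows "two_phase_solution X1 X2 L R R (\<lambda>x. Re (c * u x)) (\<lambda>x. Re (\<i> * c * w x))"
proof -
  have X: "X1 \<in> sets lebesgue" "X2 \<in> sets lebesgue"
    and cont: "continuous_on {0..L} u" "continuous_on {0..L} w"
    using sol by (auto simp: two_phase_solution_def)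
  have Re_int: "integral {s..t} (\<lambda>x. indicator X x *\<^sub>R Re (a * g x))
      = Re (a * integral {s..t} (\<lambda>x. indicator X x *\<^sub>R g x))"
    if "X \<in> sets lebesgue" "continuous_on {0..L} g" "0 \<le> s" "t \<le> L" for X g s t a
  proof -
    have "bounded_linear (\<lambda>v. Re (a * v))"
      by (rule bounded_linear_compose[OF bounded_linear_Re bounded_linear_mult_right])
    moreover have "(\<lambda>x. indicator X x *\<^sub>R g x) integrable_on {s..t}"
      using that by (intro indicator_continuous_integrable_on continuous_on_subset[OF that(2)]) auto
    ultimately have "integral {s..t} ((\<lambda>v. Re (a * v)) \<circ> (\<lambda>x. indicator X x *\<^sub>R g x))
        = Re (a * integral {s..t} (\<lambda>x. indicator X x *\<^sub>R g x))"
      by (intro integral_linear)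
    moreover have "(\<lambda>v. Re (a * v)) \<circ> (\<lambda>x. indicator X x *\<^sub>R g x) = (\<lambda>x. indicator X x *\<^sub>R Re (a * g x))"
      by (auto simp: algebra_simps)
    ultimately show ?thesis
      by simp
  qed
  show ?thesis
    unfolding two_phase_solution_def
  proof (intro conjI allI impI X)
    show "continuous_on {0..L} (\<lambda>x. Re (c * u x))" "continuous_on {0..L} (\<lambda>x. Re (\<i> * c * w x))"
      by (intro continuous_intros cont)+
    fix s t assume "0 \<le> s \<and> s \<le> t \<and> t \<le> L"
    then have st: "0 \<le> s" "s \<le> t" "t \<le> L"
      by auto
    show "Re (c * u t) = Re (c * u s) + R * integral {s..t} (\<lambda>x. indicator X2 x *\<^sub>R Re (\<i> * c * w x))"
      unfolding Re_int[OF X(2) cont(2) st(1,3)] two_phase_solutionD(1)[OF sol st]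
      by (simp add: algebra_simps)
    show "Re (\<i> * c * w t) = Re (\<i> * c * w s) + R * integral {s..t} (\<lambda>x. indicator X1 x *\<^sub>R Re (c * u x))"
      unfolding Re_int[OF X(1) cont(1) st(1,3)] two_phase_solutionD(2)[OF sol st]
      by (simp add: algebra_simps)
  qed
qed

section \<open>Reduction of the canonical system to two-phase columns\<close>

context
  fixes H :: "real \<Rightarrow> complex^2^2" and L :: real
    and M :: "real \<Rightarrow> complex \<Rightarrow> complex^2^2" and X1 X2 :: "real set"
  assumes sys: "canonical_system H L" and M: "monodromy_matrix H L M"
    and two_phase: "AE x in lebesgue_on {0..L}. H x = frakH1 \<or> H x = frakH2"
  defines "X1 \<equiv> {x \<in> {0<..<L}. H x = frakH1}" and "X2 \<equiv> {x \<in> {0<..<L}. H x = frakH2}"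
begin

lemma Hamiltonian_measurable: "H \<in> borel_measurable (lebesgue_on {0..L})"
  using sys by (auto simp: canonical_system_def)

lemma phases_measurable: "X1 \<in> sets lebesgue" "X2 \<in> sets lebesgue"
proof -
  have "{x \<in> {0<..<L}. H x = A} \<in> sets lebesgue" for A
  proof -
    have "H -` {A} \<inter> space (lebesgue_on {0..L}) \<in> sets (lebesgue_on {0..L})"
      by (rule measurable_sets[OF Hamiltonian_measurable]) simp
    then have "H -` {A} \<inter> {0..L} \<in> sets lebesgue"
      by (simp add: sets_restrict_space_iff space_restrict_space)
    then have "H -` {A} \<inter> {0..L} \<inter> {0<..<L} \<in> sets lebesgue"
      by auto
    moreover have "H -` {A} \<inter> {0..L} \<inter> {0<..<L} = {x \<in> {0<..<L}. H x = A}"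
      by auto
    ultimately show ?thesis
      by simp
  qed
  then show "X1 \<in> sets lebesgue" "X2 \<in> sets lebesgue"
    by (auto simp: X1_def X2_def)
qed

text \<open>Almost everywhere \<open>H\<close> is the combination of \<open>frakH1\<close> and
  \<open>frakH2\<close> with the phase indicators as coefficients, and multiplying by these
  projections keeps the first or the second row of \<open>M\<close>.\<close>

lemma Hamiltonian_integral_component:
  assumes x: "0 \<le> x" "x \<le> L"
  shows "(LINT t|lebesgue_on {0..x}. H t ** M t z) $ 1 $ j = integral {0..x} (\<lambda>t. indicator X1 t *\<^sub>R M t z $ 1 $ j)"
    and "(LINT t|lebesgue_on {0..x}. H t ** M t z) $ 2 $ j = integral {0..x} (\<lambda>t. indicator X2 t *\<^sub>R M t z $ 2 $ j)"
proof -
  define G where "G t = indicator X1 t *\<^sub>R (frakH1 ** M t z) + indicator X2 t *\<^sub>R (frakH2 ** M t z)" for t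
  have M_cont: "continuous_on {0..x} (\<lambda>t. M t z)"
    by (rule continuous_on_subset[where s = "{0..L}"]) (use M x in \<open>auto simp: monodromy_matrix_def\<close>)
  have mult_cont: "continuous_on {0..x} (\<lambda>t. A ** M t z)" for A :: "complex^2^2"
    unfolding matrix_matrix_mult_def by (intro continuous_intros continuous_on_vec_lambda M_cont)
  have G_int: "integrable (lebesgue_on {0..x}) G"
    unfolding G_def
    by (intro Bochner_Integration.integrable_add integrable_indicator_continuous mult_cont phases_measurable)
  have HM: "(\<lambda>t. H t ** M t z) \<in> borel_measurable (lebesgue_on {0..x})"
  proof (rule borel_measurable_continuous_Pair[where H = "(**)"])
    show "H \<in> borel_measurable (lebesgue_on {0..x})"
      by (rule measurable_restrict_mono[OF Hamiltonian_measurable]) (use x in auto)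
    show "(\<lambda>t. M t z) \<in> borel_measurable (lebesgue_on {0..x})"
      by (rule continuous_imp_measurable_on_sets_lebesgue[OF M_cont]) simp
    show "continuous_on UNIV (\<lambda>p :: (complex^2^2) \<times> (complex^2^2). fst p ** snd p)"
      unfolding matrix_matrix_mult_def by (intro continuous_intros continuous_on_vec_lambda)
  qed
  have ae: "AE t in lebesgue_on {0..x}. H t ** M t z = G t"
  proof -
    \<comment> \<open>\<open>X1\<close> and \<open>X2\<close> lie in the open interval, so both
      indicators vanish at 0 and L whatever \<open>H\<close> is there.\<close>
    have "{0, L} \<in> null_sets lebesgue"
      by (simp add: negligible_iff_null_sets[symmetric])
    then have "AE t in lebesgue. t \<notin> {0, L}"
      by (rule AE_not_in)
    moreover have "AE t in lebesgue. t \<in> {0..L} \<longrightarrow> H t = frakH1 \<or> H t = frakH2"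
      using two_phase by (simp add: AE_restrict_space_iff)
    ultimately have "AE t in lebesgue. t \<in> {0..x} \<longrightarrow> H t ** M t z = G t"
    proof eventually_elim
      case (elim t)
      \<comment> \<open>The phases are disjoint, so exactly one term of \<open>G\<close> survives at
        each remaining point.\<close>
      have "frakH1 $ 1 $ 1 \<noteq> frakH2 $ 1 $ 1"
        by (simp add: frakH1_def frakH2_def)
      then have "frakH1 \<noteq> frakH2"
        by auto
      with elim show ?case
        using x by (auto simp: G_def X1_def X2_def indicator_def)
    qed
    then show ?thesis
      by (simp add: AE_restrict_space_iff)
  qed
  have eq: "(LINT t|lebesgue_on {0..x}. H t ** M t z) = (LINT t|lebesgue_on {0..x}. G t)"
    by (rule integral_cong_AE[OF HM borel_measurable_integrable[OF G_int] ae])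
  have comp: "(LINT t|lebesgue_on {0..x}. H t ** M t z) $ i $ j = integral {0..x} (\<lambda>t. G t $ i $ j)" for i
  proof -
    have lin: "bounded_linear (\<lambda>A :: complex^2^2. A $ i $ j)"
      by (rule bounded_linear_compose[OF bounded_linear_vec_nth bounded_linear_vec_nth])
    have "integrable (lebesgue_on {0..x}) (\<lambda>t. G t $ i $ j)"
      by (rule integrable_bounded_linear[OF lin G_int])
    then have "(LINT t|lebesgue_on {0..x}. G t $ i $ j) = integral {0..x} (\<lambda>t. G t $ i $ j)"
      by (rule lebesgue_integral_eq_integral) simp
    then show ?thesis
      unfolding eq using integral_bounded_linear[OF lin G_int] by simp
  qed
  have "G t $ 1 $ j = indicator X1 t *\<^sub>R M t z $ 1 $ j" "G t $ 2 $ j = indicator X2 t *\<^sub>R M t z $ 2 $ j" for t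
    by (auto simp: G_def matrix_matrix_mult_def frakH1_def frakH2_def sum_2)
  then show "(LINT t|lebesgue_on {0..x}. H t ** M t z) $ 1 $ j = integral {0..x} (\<lambda>t. indicator X1 t *\<^sub>R M t z $ 1 $ j)"
    "(LINT t|lebesgue_on {0..x}. H t ** M t z) $ 2 $ j = integral {0..x} (\<lambda>t. indicator X2 t *\<^sub>R M t z $ 2 $ j)"
    unfolding comp by simp_all
qed

text \<open>\<open>symplJ\<close> exchanges the rows and negates the one that moves up, so the first
  row of the matrix equation governs the second entry of a column and conversely.\<close>

lemma monodromy_column_from_0:
  assumes x: "0 \<le> x" "x \<le> L"
  shows "M x z $ 1 $ j = mat 1 $ 1 $ j + z * integral {0..x} (\<lambda>t. indicator X2 t *\<^sub>R M t z $ 2 $ j)"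
    and "M x z $ 2 $ j = mat 1 $ 2 $ j - z * integral {0..x} (\<lambda>t. indicator X1 t *\<^sub>R M t z $ 1 $ j)"
proof -
  have "symplJ ** (M x z - mat 1) = mat z ** (LINT t|lebesgue_on {0..x}. H t ** M t z)"
    using M x by (auto simp: monodromy_matrix_def)
  then have "(symplJ ** (M x z - mat 1)) $ i $ j = (mat z ** (LINT t|lebesgue_on {0..x}. H t ** M t z)) $ i $ j" for i
    by simp
  moreover have "(mat z ** A) $ i $ j = z * A $ i $ j" for A :: "complex^2^2" and i
    by (simp add: matrix_matrix_mult_def mat_def if_distrib if_distribR sum.delta cong: if_cong)
  moreover have "(symplJ ** A) $ 1 $ j = - A $ 2 $ j" "(symplJ ** A) $ 2 $ j = A $ 1 $ j" for A :: "complex^2^2"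
    by (auto simp: matrix_matrix_mult_def symplJ_def sum_2)
  ultimately have "- (M x z - mat 1) $ 2 $ j = z * (LINT t|lebesgue_on {0..x}. H t ** M t z) $ 1 $ j"
    "(M x z - mat 1) $ 1 $ j = z * (LINT t|lebesgue_on {0..x}. H t ** M t z) $ 2 $ j"
    by metis+
  then show "M x z $ 1 $ j = mat 1 $ 1 $ j + z * integral {0..x} (\<lambda>t. indicator X2 t *\<^sub>R M t z $ 2 $ j)"
    "M x z $ 2 $ j = mat 1 $ 2 $ j - z * integral {0..x} (\<lambda>t. indicator X1 t *\<^sub>R M t z $ 1 $ j)"
    unfolding Hamiltonian_integral_component[OF x] by (auto simp: algebra_simps)
qed

lemma monodromy_column_two_phase:
  "two_phase_solution X1 X2 L z (- z) (\<lambda>x. M x z $ 1 $ j) (\<lambda>x. M x z $ 2 $ j)"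
  unfolding two_phase_solution_def
proof (intro conjI allI impI phases_measurable)
  have cont: "continuous_on {0..L} (\<lambda>x. M x z $ i $ j)" for i
    using M by (intro continuous_on_component) (auto simp: monodromy_matrix_def)
  then show "continuous_on {0..L} (\<lambda>x. M x z $ 1 $ j)" "continuous_on {0..L} (\<lambda>x. M x z $ 2 $ j)"
    by auto
  fix s t assume st: "0 \<le> s \<and> s \<le> t \<and> t \<le> L"
  have split: "integral {0..t} (\<lambda>x. indicator X x *\<^sub>R M x z $ i $ j)
      = integral {0..s} (\<lambda>x. indicator X x *\<^sub>R M x z $ i $ j) + integral {s..t} (\<lambda>x. indicator X x *\<^sub>R M x z $ i $ j)"
    if "X \<in> sets lebesgue" for X i
    by (rule Henstock_Kurzweil_Integration.integral_combine[symmetric])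
      (use st in \<open>auto intro!: indicator_continuous_integrable_on that continuous_on_subset[OF cont]\<close>)
  show "M t z $ 1 $ j = M s z $ 1 $ j + z * integral {s..t} (\<lambda>x. indicator X2 x *\<^sub>R M x z $ 2 $ j)"
    using monodromy_column_from_0(1)[of s z j] monodromy_column_from_0(1)[of t z j] st
    by (simp add: split[OF phases_measurable(2)] distrib_left)
  show "M t z $ 2 $ j = M s z $ 2 $ j + - z * integral {s..t} (\<lambda>x. indicator X1 x *\<^sub>R M x z $ 1 $ j)"
    using monodromy_column_from_0(2)[of s z j] monodromy_column_from_0(2)[of t z j] st
    by (simp add: split[OF phases_measurable(1)] distrib_left)
qed

lemma monodromy_at_0: "M 0 z = mat 1"
  using sys monodromy_column_from_0[of 0 z]
  by (simp add: vec_eq_iff forall_2 canonical_system_def)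

lemma monodromy_entry_order_le:
  assumes "0 < d" "admissible_exponent X1 X2 L d"
  shows "growth_order (\<lambda>z. M L z $ i $ j) \<le> ereal d"
proof -
  have X: "X1 \<subseteq> {0..L}" "X2 \<subseteq> {0..L}" and L: "0 \<le> L"
    using sys by (auto simp: X1_def X2_def canonical_system_def)
  have init: "cmod (M 0 z $ 1 $ j) + cmod (M 0 z $ 2 $ j) = 1" for z
    using exhaust_2[of j] by (auto simp: monodromy_at_0 mat_def)
  show ?thesis
    using two_phase_growth_order_le[OF monodromy_column_two_phase init X L assms]
      exhaust_2[of i] by auto
qed

text \<open>Growth on the imaginary axis alone suffices: at z = iR the rotated column is a real
  two-phase solution whose components are dominated by the moduli of the entries.\<close>

lemma admissible_exponent_above_entry_order:
  assumes "growth_order (\<lambda>z. M L z $ i $ j) < ereal d" "0 < d"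
  shows "admissible_exponent X1 X2 L d"
proof (rule admissible_exponent_of_growth)
  show "0 < L"
    using sys by (simp add: canonical_system_def)
  \<comment> \<open>The phase \<open>c\<close> gives the rotated column \<open>j\<close> the nonnegative initial value (1,0) or (0,1).\<close>
  define c where "c = (if j = 1 then 1 else - \<i>)"
  have "filterlim (\<lambda>R. \<i> * complex_of_real R) at_infinity at_top"
    by (rule filterlim_norm_at_top_imp_at_infinity) (simp add: norm_mult filterlim_abs_real)
  from eventually_compose_filterlim[OF growth_order_lessD[OF assms(1)] this] eventually_gt_at_top[of 0]
  show "\<forall>\<^sub>F R in at_top. \<exists>u w :: real \<Rightarrow> real. two_phase_solution X1 X2 L R R u w \<and>
      (u 0 = 1 \<and> w 0 = 0 \<or> u 0 = 0 \<and> w 0 = 1) \<and> (u L \<le> exp (R powr d) \<or> w L \<le> exp (R powr d))"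
  proof eventually_elim
    case (elim R)
    let ?z = "\<i> * complex_of_real R"
    define u where "u x = Re (c * M x ?z $ 1 $ j)" for x
    define w where "w x = Re (\<i> * c * M x ?z $ 2 $ j)" for x
    have "two_phase_solution X1 X2 L R R u w"
      unfolding u_def w_def by (rule two_phase_solution_Re[OF monodromy_column_two_phase])
    moreover have "u 0 = 1 \<and> w 0 = 0 \<or> u 0 = 0 \<and> w 0 = 1"
      using exhaust_2[of j] by (auto simp: u_def w_def c_def monodromy_at_0 mat_def)
    moreover have "u L \<le> cmod (M L ?z $ 1 $ j)" "w L \<le> cmod (M L ?z $ 2 $ j)"
      unfolding u_def w_def by (rule order_trans[OF complex_Re_le_cmod], simp add: c_def norm_mult)+
    moreover have "cmod (M L ?z $ i $ j) \<le> exp (R powr d)"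
      using elim by (simp add: norm_mult)
    moreover have "u L \<le> exp (R powr d) \<or> w L \<le> exp (R powr d)"
      using calculation(3-5) exhaust_2[of i] by auto
    ultimately show ?case
      by blast
  qed
qed (rule assms(2))

end

text \<open>A single interval covering the whole line works: for d = 1 the bound in (A) is a
  constant. This gives the order bound 1 when no smaller exponent is admissible.\<close>

lemma admissible_exponent_1:
  assumes "X1 \<subseteq> {0..L}" "X2 \<subseteq> {0..L}"
  shows "admissible_exponent X1 X2 L 1"
  unfolding admissible_exponent_def
proof (intro exI[of _ "1 + sqrt (measure lebesgue X1 * measure lebesgue X2)"] conjI)
  show "\<forall>\<^sub>F R in at_top. \<exists>(n::nat) (\<omega> :: nat \<Rightarrow> real set).
        (\<forall>j<n. is_interval (\<omega> j)) \<and> {0<..<L} \<subseteq> (\<Union>j<n. \<omega> j) \<and>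
        (\<Sum>j<n. sqrt (measure lebesgue (\<omega> j \<inter> X1) * measure lebesgue (\<omega> j \<inter> X2)))
          \<le> (1 + sqrt (measure lebesgue X1 * measure lebesgue X2)) * R powr (1 - 1) \<and>
        real n \<le> (1 + sqrt (measure lebesgue X1 * measure lebesgue X2)) * R powr 1"
    using eventually_ge_at_top[of 1]
  proof eventually_elim
    case (elim R)
    have "1 * 1 \<le> (1 + sqrt (measure lebesgue X1 * measure lebesgue X2)) * R"
      using elim by (intro mult_mono) auto
    then show ?case
      using elim by (intro exI[of _ "1::nat"] exI[of _ "\<lambda>_. UNIV"]) auto
  qed
qed (simp add: add_pos_nonneg)

theorem theorem2:
  fixes H :: "real \<Rightarrow> complex^2^2" and L :: real
    and M :: "real \<Rightarrow> complex \<Rightarrow> complex^2^2"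
    and X1 X2 :: "real set"
  assumes "canonical_system H L"
    and "monodromy_matrix H L M"
    and "AE x in lebesgue_on {0..L}. H x = frakH1 \<or> H x = frakH2"
    and "X1 = {x \<in> {0<..<L}. H x = frakH1}"
    and "X2 = {x \<in> {0<..<L}. H x = frakH2}"
  \<comment> \<open>1 is inserted because the infimum is taken within (0,1]: no d < 1 need be
     admissible, and then the order is 1.\<close>
  shows "\<forall>i j. growth_order (\<lambda>z. M L z $ i $ j) =
    Inf (insert 1 {ereal d | d. 0 < d \<and> d < 1 \<and> admissible_exponent X1 X2 L d})"
proof (intro allI antisym)
  fix i j
  let ?D = "insert 1 {ereal d | d. 0 < d \<and> d < 1 \<and> admissible_exponent X1 X2 L d}"
  let ?\<rho> = "growth_order (\<lambda>z. M L z $ i $ j)"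
  note upper = monodromy_entry_order_le[OF assms(1-3), folded assms(4,5)]
  note lower = admissible_exponent_above_entry_order[OF assms(1-3), folded assms(4,5)]
  have "X1 \<subseteq> {0..L}" "X2 \<subseteq> {0..L}"
    using assms(4,5) by auto
  then have "admissible_exponent X1 X2 L 1"
    by (rule admissible_exponent_1)
  \<comment> \<open>Every admissible exponent bounds the order from above, and 1 is
    admissible.\<close>
  then show "?\<rho> \<le> Inf ?D"
    using upper[of 1 i j] by (auto intro!: Inf_greatest upper simp: one_ereal_def)
  show "Inf ?D \<le> ?\<rho>"
  proof (rule ccontr)
    assume "\<not> Inf ?D \<le> ?\<rho>"
    \<comment> \<open>Such a \<open>d\<close> lies in (0, 1), since orders are nonnegative and 1 is
      in the set. Being above the order it is admissible, hence an element of the set below its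
      infimum.\<close>
    then obtain d where d: "?\<rho> < ereal d" "ereal d < Inf ?D"
      using ereal_dense2[of ?\<rho> "Inf ?D"] by (auto simp: not_le)
    have "0 < ereal d"
      using growth_order_nonneg d(1) by (rule le_less_trans)
    moreover have "ereal d < 1"
      using d(2) Inf_lower[of 1 ?D] by (simp add: less_le_trans)
    ultimately have "ereal d \<in> ?D"
      using lower[OF d(1)] by (auto simp: one_ereal_def)
    then have "Inf ?D \<le> ereal d"
      by (rule Inf_lower)
    then show False
      using d(2) leD by blast
  qed
qed

end
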